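(* Let $\mathbf k$ be a field of characteristic $0$, $\lambda\in\mathbf k$, $\mathfrak g$ a graded vector space over $\mathbf k$ and $\mathfrak l=s\mathfrak g$. A homotopy differential Lie algebra structure of weight $\lambda$ on $\mathfrak g$ is equivalent to a pair $(\mu=\{\mu_i\}_{i\ge1},D=\{D_i\}_{i\ge1})$, where $\mu_i:S^i(\mathfrak l)\to\mathfrak l$ has degree $1$ and $D_i:S^i(\mathfrak l)\to\mathfrak l$ has degree $0$, such that for all $n\ge1$ and homogeneous $x_1,\dots,x_n\in\mathfrak l$: $$\sum_{i=1}^n\sum_{\sigma\in\mathrm{Sh}(i,n-i)}\varepsilon(\sigma)\mu_{n-i+1}(\mu_i(x_{\sigma(1)},\dots,x_{\sigma(i)}),x_{\sigma(i+1)},\dots,x_{\sigma(n)})=0$$ (i.e. $(\mathfrak l,\mu)$ is an $L_\infty[1]$-algebra), and $$\sum_{p\ge2}\sum_{t=p-1}^n\ \sum_{m_1+\cdots+m_{p-1}=t}\ \sum_{\sigma}\varepsilon(\sigma)\lambda^{p-2}\mu_{n-t+p-1}\big(D_{m_{p-1}}(x_{\sigma(1)},\dots,x_{\sigma(m_{p-1})}),\dots,D_{m_1}(x_{\sigma(m_2+\cdots+m_{p-1}+1)},\dots,x_{\sigma(t)}),x_{\sigma(t+1)},\dots,x_{\sigma(n)}\big)$$ $$-\sum_{j=1}^n\sum_{\sigma\in\mathrm{Sh}(j,n-j)}\varepsilon(\sigma)D_{n-j+1}(\mu_j(x_{\sigma(1)},\dots,x_{\sigma(j)}),x_{\sigma(j+1)},\dots,x_{\sigma(n)})=0,$$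 where all $m_k\ge1$ and the inner sum in the first line is over $\sigma\in\mathrm{Sh}(m_{p-1},\dots,m_1,n-t)$ satisfying $\sigma(1)<\sigma(m_{p-1}+1)<\sigma(m_{p-1}+m_{p-2}+1)<\cdots<\sigma(m_{p-1}+\cdots+m_2+1)$. (The correspondence sends $(\mu,D)$ to the Maurer-Cartan element $(s\sum_i\mu_i,\sum_iD_i)$ of $sM\oplus A$.)
   Context: Graded spaces are $\mathbb Z$-graded, $(sV)^n=V^{n+1}$; $S^n(V)$ is the $n$-th graded symmetric power, $\bar S(V)=\bigoplus_{n\ge1}S^n(V)$; $\varepsilon(\sigma)$ is the Koszul sign defined by $x_1\odot\dots\odot x_n=\varepsilon(\sigma)x_{\sigma(1)}\odot\dots\odot x_{\sigma(n)}$; $\mathrm{Sh}(i_1,\dots,i_r)$ is the set of permutations increasing on the consecutive blocks of sizes $i_1,\dots,i_r$; $\lambda^0=1$. An $L_\infty[1]$-algebra is a graded vector space $\mathfrak L$ with graded symmetric degree $1$ maps $l_n:\mathfrak L^{\otimes n}\to\mathfrak L$, $n\ge1$, with $\sum_{i=1}^n\sum_{\sigma\in\mathrm{Sh}(i,n-i)}\varepsilon(\sigma)l_{n-i+1}(l_i(x_{\sigma(1)},\dots,x_{\sigma(i)}),x_{\sigma(i+1)},\dots,x_{\sigma(n)})=0$ for all $n\ge1$. A Maurer-Cartan element is $\alpha\in\mathfrak L^0$ with $\sum_{n\ge1}\frac1{n!}l_n(\alpha^{\otimes n})=0$. A homotopy differential Lie algebra structure of weight $\lambda$ on $\mathfrak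 g$ is, by definition, a Maurer-Cartan element of the following $L_\infty[1]$-algebra $sM\oplus A$. As graded spaces $M=A=\mathrm{Hom}(\bar S(\mathfrak l),\mathfrak l)$ (graded by degree of maps). For $f\in\mathrm{Hom}(S^n(\mathfrak l),\mathfrak l)$ of degree $p$ and $g\in\mathrm{Hom}(S^m(\mathfrak l),\mathfrak l)$ of degree $q$, $[f,g]_{\mathrm{NR}}=f\bar\circ g-(-1)^{pq}g\bar\circ f$ with $f\bar\circ g(v_1,\dots,v_{m+n-1})=\sum_{\sigma\in\mathrm{Sh}(m,n-1)}\varepsilon(\sigma)f(g(v_{\sigma(1)},\dots,v_{\sigma(m)}),v_{\sigma(m+1)},\dots,v_{\sigma(m+n-1)})$. Operations: $l_2(sf,sg)=(-1)^{|f|}s[f,g]_{\mathrm{NR}}$, $l_2(sf,\xi)=[f,\xi]_{\mathrm{NR}}$, and for $3\le i\le n+2$ $$l_i(sf,\xi_1,\dots,\xi_{i-1})=\sum_{\tau\in\mathrm{Sh}(m_{i-1}+1,\dots,m_1+1,n+2-i)}(-1)^{\sum_{j=1}^{i-1}(|\xi_1|+\cdots+|\xi_{j-1}|)|\xi_j|}\lambda^{i-2}f(\xi_{i-1}\otimes\cdots\otimes\xi_1\otimes\mathrm{Id}^{\otimes n+2-i})\tau^{-1}$$ for $f\in\mathrm{Hom}(S^{n+1}(\mathfrak l),\mathfrak l)\subseteq M$, $\xi_j\in\mathrm{Hom}(S^{m_j+1}(\mathfrak l),\mathfrak l)\subseteq A$, extended by graded symmetry, other components zero; $\tau^{-1}(v_1,\dots,v_t)=\varepsilon(\tau)(v_{\tau(1)},\dots,v_{\tau(t)})$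 and tensor products of maps are evaluated by the Koszul rule. Operations and the Maurer-Cartan sum are taken arity by arity, where each output arity involves only finitely many terms. *)

theory Defs
  imports Complex_Main "HOL-Combinatorics.Permutations" "HOL-Library.FuncSet"
begin

section \<open>Graded vector spaces\<close>

text \<open>A graded vector space is a vector space (a whole type) together with a direct sum
  decomposition into subspaces \<open>V d\<close>, indexed by the integers.\<close>

locale graded_vector_space = vector_space scale
  for scale :: "'k::field \<Rightarrow> 'v::ab_group_add \<Rightarrow> 'v" +
  fixes V :: "int \<Rightarrow> 'v set"
  assumes subspace_component: "subspace (V d)"
    and decomposition:
      "\<exists>!c. (\<forall>d. c d \<in> V d) \<and> finite {d. c d \<noteq> 0} \<and> x = (\<Sum>d | c d \<noteq> 0. c d)"

definition hcomp :: "(int \<Rightarrow> 'v::ab_group_add set) \<Rightarrow> 'v \<Rightarrow> int \<Rightarrow> 'v" where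
  "hcomp V x =
    (THE c. (\<forall>d. c d \<in> V d) \<and> finite {d. c d \<noteq> 0} \<and> x = (\<Sum>d | c d \<noteq> 0. c d))"

text \<open>The suspension \<open>sV\<close> has the same underlying vector space; \<open>s\<close> is the identity map,
  so that \<open>x \<in> V d\<close> has degree \<open>d - 1\<close> when regarded as \<open>sx\<close>.\<close>

definition susp :: "(int \<Rightarrow> 'a set) \<Rightarrow> int \<Rightarrow> 'a set" where
  "susp V n = V (n + 1)"

text \<open>\<open>homog V es xs\<close>: the list \<open>xs\<close> consists of homogeneous elements of degrees \<open>es\<close>.
  Degrees are carried explicitly, because \<open>0\<close> has every degree.\<close>

definition homog :: "(int \<Rightarrow> 'v set) \<Rightarrow> int list \<Rightarrow> 'v list \<Rightarrow> bool" where
  "homog V es xs \<longleftrightarrow> list_all2 (\<lambda>e x. x \<in> V e) es xs"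


section \<open>Shuffles and Koszul signs\<close>

text \<open>Permutations act on positions \<open>0, \<dots>, n - 1\<close>, and
  \<open>permute_list \<sigma> [x\<^sub>0, \<dots>] = [x (\<sigma> 0), \<dots>]\<close>. Blocks of size \<open>0\<close> are allowed.\<close>

definition Sh :: "nat list \<Rightarrow> (nat \<Rightarrow> nat) set" where
  "Sh bs = {\<sigma>. \<sigma> permutes {..<sum_list bs} \<and>
     (\<forall>k < length bs. strict_mono_on {sum_list (take k bs)..<sum_list (take (Suc k) bs)} \<sigma>)}"

text \<open>The sign in \<open>x\<^sub>0 \<odot> \<dots> \<odot> x\<^sub>n = \<epsilon>(\<sigma>) x (\<sigma> 0) \<odot> \<dots> \<odot> x (\<sigma> n)\<close> for \<open>x\<^sub>i\<close> of degree \<open>es ! i\<close>: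
  every pair whose order is reversed contributes \<open>(-1)\<close> to the product of its degrees.\<close>

definition koszul :: "int list \<Rightarrow> (nat \<Rightarrow> nat) \<Rightarrow> 'k::field" where
  "koszul es \<sigma> =
    (\<Prod>(i, j) \<in> {(i, j). i < j \<and> j < length es \<and> \<sigma> j < \<sigma> i}. (-1) powi (es ! \<sigma> i * es ! \<sigma> j))"


section \<open>The graded space \<open>Hom(\<bar>S(V), V)\<close>\<close>

text \<open>Linear maps out of \<open>S\<^sup>n(V)\<close> are graded symmetric \<open>n\<close>-linear maps. A map with arguments in
  \<open>V\<close> is a function on lists; one of arity \<open>n\<close> vanishes on lists of any other length.
  \<open>Hom_Sym scale V n p\<close> is the degree \<open>p\<close> part of \<open>Hom(S\<^sup>n(V), V)\<close>.\<close>

type_synonym 'v mmap = "'v list \<Rightarrow> 'v"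

definition Hom_Sym ::
  "('k::field \<Rightarrow> 'v::ab_group_add \<Rightarrow> 'v) \<Rightarrow> (int \<Rightarrow> 'v set) \<Rightarrow> nat \<Rightarrow> int \<Rightarrow> 'v mmap set" where
  "Hom_Sym scale V n p = {f.
     (\<forall>xs. length xs \<noteq> n \<longrightarrow> f xs = 0) \<and>
     (\<forall>xs i. length xs = n \<and> i < n \<longrightarrow> Vector_Spaces.linear scale scale (\<lambda>y. f (xs[i := y]))) \<and>
     (\<forall>es xs. length xs = n \<and> homog V es xs \<longrightarrow> f xs \<in> V (sum_list es + p)) \<and>
     (\<forall>es xs \<sigma>. length xs = n \<and> homog V es xs \<and> \<sigma> permutes {..<n} \<longrightarrow>
        f xs = scale (koszul es \<sigma>) (f (permute_list \<sigma> xs)))}"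

text \<open>Since \<open>\<bar>S(V)\<close> is the direct sum of the \<open>S\<^sup>n(V)\<close>, \<open>n \<ge> 1\<close>, a linear map on it is an arbitrary
  family of maps, one in each arity. Such a family is again a single function on lists, the
  arity being the length of the argument.\<close>

definition arity_part :: "nat \<Rightarrow> 'v::zero mmap \<Rightarrow> 'v mmap" where
  "arity_part n F = (\<lambda>xs. if length xs = n then F xs else 0)"

definition Hom_Sbar ::
  "('k::field \<Rightarrow> 'v::ab_group_add \<Rightarrow> 'v) \<Rightarrow> (int \<Rightarrow> 'v set) \<Rightarrow> int \<Rightarrow> 'v mmap set" where
  "Hom_Sbar scale V p = {F. F [] = 0 \<and> (\<forall>n\<ge>1. arity_part n F \<in> Hom_Sym scale V n p)}"

text \<open>The sum \<open>\<Sum>\<^sub>i \<mu>\<^sub>i\<close> of maps \<open>\<mu>\<^sub>i\<close> of arity \<open>i \<ge> 1\<close>; \<open>\<mu> 0\<close> is disregarded.\<close>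

definition sum_arities :: "(nat \<Rightarrow> 'v::zero mmap) \<Rightarrow> 'v mmap" where
  "sum_arities \<mu> = (\<lambda>xs. if xs = [] then 0 else \<mu> (length xs) xs)"

text \<open>Formulas involving Koszul signs are given on homogeneous arguments (with their degrees) and
  are extended multilinearly to all arguments.\<close>

definition ml_ext ::
  "(int \<Rightarrow> 'v::ab_group_add set) \<Rightarrow> (int list \<Rightarrow> 'v list \<Rightarrow> 'v) \<Rightarrow> 'v mmap" where
  "ml_ext V G xs =
    (\<Sum>es \<in> listset (map (\<lambda>x. {d. hcomp V x d \<noteq> 0}) xs). G es (map2 (hcomp V) xs es))"


section \<open>The operations\<close>

text \<open>\<open>F \<bar>\<circ> G\<close>, extended biadditively to families: on \<open>N\<close> arguments the components \<open>G\<^sub>m\<close> and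
  \<open>F\<^sub>n\<close> with \<open>m + n - 1 = N\<close> contribute.\<close>

definition pre_comp ::
  "('k::field \<Rightarrow> 'v::ab_group_add \<Rightarrow> 'v) \<Rightarrow> (int \<Rightarrow> 'v set) \<Rightarrow> 'v mmap \<Rightarrow> 'v mmap \<Rightarrow> 'v mmap" where
  "pre_comp scale V F G = ml_ext V (\<lambda>es vs.
     \<Sum>m = 1..length vs. \<Sum>\<sigma> \<in> Sh [m, length vs - m].
       scale (koszul es \<sigma>)
         (F (G (take m (permute_list \<sigma> vs)) # drop m (permute_list \<sigma> vs))))"

text \<open>\<open>p\<close> and \<open>q\<close> are the degrees of \<open>F\<close> and \<open>G\<close>.\<close>

definition nr_bracket ::
  "('k::field \<Rightarrow> 'v::ab_group_add \<Rightarrow> 'v) \<Rightarrow> (int \<Rightarrow> 'v set) \<Rightarrow>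
     int \<Rightarrow> 'v mmap \<Rightarrow> int \<Rightarrow> 'v mmap \<Rightarrow> 'v mmap" where
  "nr_bracket scale V p F q G = (\<lambda>xs.
     pre_comp scale V F G xs - scale ((-1) powi (p * q)) (pre_comp scale V G F xs))"

text \<open>Evaluation of \<open>\<phi>\<^sub>1 \<otimes> \<dots> \<otimes> \<phi>\<^sub>r \<otimes> Id \<otimes> \<dots> \<otimes> Id\<close>, without and with the exponent of the Koszul
  sign: every \<open>\<phi>\<^sub>b\<close> moves past the arguments of all \<open>\<phi>\<^sub>a\<close> with \<open>a < b\<close>. The lists contain pairs of
  arity and map, resp. arity and degree.\<close>

fun tensor_val :: "(nat \<times> 'v mmap) list \<Rightarrow> 'v list \<Rightarrow> 'v list" where
  "tensor_val [] xs = xs"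
| "tensor_val ((k, \<phi>) # \<phi>s) xs = \<phi> (take k xs) # tensor_val \<phi>s (drop k xs)"

fun tensor_exponent :: "(nat \<times> int) list \<Rightarrow> int list \<Rightarrow> int" where
  "tensor_exponent [] es = 0"
| "tensor_exponent ((k, q) # \<phi>s) es =
     sum_list (map snd \<phi>s) * sum_list (take k es) + tensor_exponent \<phi>s (drop k es)"

text \<open>The \<open>A\<close>-valued operation \<open>l\<^sub>i(sF, \<xi>\<^sub>1, \<dots>, \<xi>\<^sub>r)\<close>, \<open>r = i - 1 \<ge> 2\<close>, where \<open>\<xi>\<^sub>j\<close> has degree
  \<open>qs ! (j - 1)\<close>. The sum over \<open>ks\<close> is the extension to families: \<open>\<xi>\<^sub>j\<close> contributes its component of
  arity \<open>k\<^sub>j = m\<^sub>j + 1\<close>, and the component of \<open>F\<close> that contributes has arity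
  \<open>n + 1 = r + (N - \<Sum>k\<^sub>j)\<close>, \<open>N\<close> being the number of arguments; the number of identity factors is
  \<open>n + 2 - i = N - \<Sum>k\<^sub>j \<ge> 0\<close>.\<close>

definition higher_op ::
  "('k::field \<Rightarrow> 'v::ab_group_add \<Rightarrow> 'v) \<Rightarrow> (int \<Rightarrow> 'v set) \<Rightarrow> 'k \<Rightarrow>
     'v mmap \<Rightarrow> int list \<Rightarrow> 'v mmap list \<Rightarrow> 'v mmap" where
  "higher_op scale V lam F qs \<xi>s = ml_ext V (\<lambda>es vs.
     \<Sum>ks | length ks = length \<xi>s \<and> (\<forall>k \<in> set ks. 1 \<le> k) \<and> sum_list ks \<le> length vs.
     \<Sum>\<tau> \<in> Sh (rev ks @ [length vs - sum_list ks]).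
       scale ((-1) powi (\<Sum>j < length qs. sum_list (take j qs) * qs ! j) * lam ^ (length \<xi>s - 1)
              * koszul es \<tau> * (-1) powi (tensor_exponent (rev (zip ks qs)) (permute_list \<tau> es)))
         (F (tensor_val (rev (zip ks \<xi>s)) (permute_list \<tau> vs))))"

definition mixed_op ::
  "('k::field \<Rightarrow> 'v::ab_group_add \<Rightarrow> 'v) \<Rightarrow> (int \<Rightarrow> 'v set) \<Rightarrow> 'k \<Rightarrow>
     int \<Rightarrow> 'v mmap \<Rightarrow> int list \<Rightarrow> 'v mmap list \<Rightarrow> 'v mmap" where
  "mixed_op scale V lam p F qs \<xi>s =
    (if length \<xi>s = 1 then nr_bracket scale V p F (qs ! 0) (\<xi>s ! 0)
     else higher_op scale V lam F qs \<xi>s)"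

text \<open>The graded space \<open>sM \<oplus> A\<close> with \<open>M = A = Hom(\<bar>S(V), V)\<close>; a pair \<open>(F, \<xi>)\<close> stands for
  \<open>sF + \<xi>\<close>.\<close>

definition sM_A ::
  "('k::field \<Rightarrow> 'v::ab_group_add \<Rightarrow> 'v) \<Rightarrow> (int \<Rightarrow> 'v set) \<Rightarrow> int \<Rightarrow> ('v mmap \<times> 'v mmap) set" where
  "sM_A scale V d = susp (Hom_Sbar scale V) d \<times> Hom_Sbar scale V d"

definition omit :: "nat \<Rightarrow> 'a list \<Rightarrow> 'a list" where
  "omit k xs = take k xs @ drop (Suc k) xs"

text \<open>\<open>l\<^sub>n(a\<^sub>0, \<dots>, a\<^sub>n\<^sub>-\<^sub>1)\<close> for homogeneous elements \<open>a\<^sub>j = sF\<^sub>j + \<xi>\<^sub>j\<close> of degrees \<open>ds ! j\<close>, so that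
  \<open>F\<^sub>j\<close> has degree \<open>ds ! j + 1\<close>. The \<open>A\<close>-component expands \<open>l\<^sub>n\<close> multilinearly: in each summand
  \<open>sF\<^sub>k\<close> is moved to the front by graded symmetry, and the other arguments are in \<open>A\<close>.\<close>

definition l_op ::
  "('k::field \<Rightarrow> 'v::ab_group_add \<Rightarrow> 'v) \<Rightarrow> (int \<Rightarrow> 'v set) \<Rightarrow> 'k \<Rightarrow>
     int list \<Rightarrow> ('v mmap \<times> 'v mmap) list \<Rightarrow> 'v mmap \<times> 'v mmap" where
  "l_op scale V lam ds as =
    (let n = length as; F = (\<lambda>k. fst (as ! k)) in
      ((\<lambda>xs. if n = 2
             then scale ((-1) powi (ds ! 0 + 1))
                    (nr_bracket scale V (ds ! 0 + 1) (F 0) (ds ! 1 + 1) (F 1) xs)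
             else 0),
       (\<lambda>xs. if 2 \<le> n
             then \<Sum>k < n. scale ((-1) powi (ds ! k * sum_list (take k ds)))
                    (mixed_op scale V lam (ds ! k + 1) (F k)
                       (omit k ds) (map snd (omit k as)) xs)
             else 0)))"

text \<open>Maurer-Cartan elements of \<open>sM \<oplus> A\<close>. For each output arity \<open>N\<close>, \<open>I\<close> is the set of those \<open>n\<close>
  for which \<open>l\<^sub>n(\<alpha>, \<dots>, \<alpha>)\<close> has a non-zero component of arity \<open>N\<close>.\<close>

definition Maurer_Cartan ::
  "('k::field_char_0 \<Rightarrow> 'v::ab_group_add \<Rightarrow> 'v) \<Rightarrow> (int \<Rightarrow> 'v set) \<Rightarrow> 'k \<Rightarrow>
     ('v mmap \<times> 'v mmap) set" where
  "Maurer_Cartan scale V lam = {\<alpha> \<in> sM_A scale V 0.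
     \<forall>N. let l = (\<lambda>n. l_op scale V lam (replicate n 0) (replicate n \<alpha>));
             I = {n. 1 \<le> n \<and> (\<exists>xs. length xs = N \<and> (fst (l n) xs \<noteq> 0 \<or> snd (l n) xs \<noteq> 0))}
         in finite I \<and>
            (\<forall>xs. length xs = N \<longrightarrow>
               (\<Sum>n \<in> I. scale (1 / fact n) (fst (l n) xs)) = 0 \<and>
               (\<Sum>n \<in> I. scale (1 / fact n) (snd (l n) xs)) = 0)}"

definition homotopy_diff_Lie ::
  "('k::field_char_0 \<Rightarrow> 'v::ab_group_add \<Rightarrow> 'v) \<Rightarrow> 'k \<Rightarrow> (int \<Rightarrow> 'v set) \<Rightarrow>
     ('v mmap \<times> 'v mmap) set" where
  "homotopy_diff_Lie scale lam G = Maurer_Cartan scale (susp G) lam"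


section \<open>The defining identities\<close>

definition L_infty1_identities ::
  "('k::field \<Rightarrow> 'v::ab_group_add \<Rightarrow> 'v) \<Rightarrow> (int \<Rightarrow> 'v set) \<Rightarrow> (nat \<Rightarrow> 'v mmap) \<Rightarrow> bool" where
  "L_infty1_identities scale V \<mu> \<longleftrightarrow>
    (\<forall>n\<ge>1. \<forall>es xs. length xs = n \<and> homog V es xs \<longrightarrow>
      (\<Sum>i = 1..n. \<Sum>\<sigma> \<in> Sh [i, n - i].
         scale (koszul es \<sigma>)
           (\<mu> (n - i + 1) (\<mu> i (take i (permute_list \<sigma> xs)) # drop i (permute_list \<sigma> xs)))) = 0)"

text \<open>\<open>ms = [m\<^sub>1, \<dots>, m\<^sub>p\<^sub>-\<^sub>1]\<close>. The sum over \<open>t\<close> is empty for \<open>p > n + 1\<close>. The monotonicity condition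
  on \<open>\<sigma>\<close> compares its values at the first positions of the blocks \<open>m\<^sub>p\<^sub>-\<^sub>1, \<dots>, m\<^sub>1\<close>.\<close>

definition diff_identities ::
  "('k::field \<Rightarrow> 'v::ab_group_add \<Rightarrow> 'v) \<Rightarrow> (int \<Rightarrow> 'v set) \<Rightarrow> 'k \<Rightarrow>
     (nat \<Rightarrow> 'v mmap) \<Rightarrow> (nat \<Rightarrow> 'v mmap) \<Rightarrow> bool" where
  "diff_identities scale V lam \<mu> D \<longleftrightarrow>
    (\<forall>n\<ge>1. \<forall>es xs. length xs = n \<and> homog V es xs \<longrightarrow>
      (\<Sum>p = 2..n + 1. \<Sum>t = p - 1..n.
       \<Sum>ms | length ms = p - 1 \<and> (\<forall>m \<in> set ms. 1 \<le> m) \<and> sum_list ms = t.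
       \<Sum>\<sigma> | \<sigma> \<in> Sh (rev ms @ [n - t]) \<and>
             strict_mono_on {..<p - 1} (\<lambda>k. \<sigma> (sum_list (take k (rev ms)))).
         scale (koszul es \<sigma> * lam ^ (p - 2))
           (\<mu> (n - t + p - 1)
              (tensor_val (map (\<lambda>m. (m, D m)) (rev ms)) (permute_list \<sigma> xs))))
      - (\<Sum>j = 1..n. \<Sum>\<sigma> \<in> Sh [j, n - j].
         scale (koszul es \<sigma>)
           (D (n - j + 1) (\<mu> j (take j (permute_list \<sigma> xs)) # drop j (permute_list \<sigma> xs)))) = 0)"

end

(*
  Evaluated on the diagonal alpha = sF + xi with |sF| = |xi| = 0, every l_n with n >= 2 collapses: in
  n / n! l_n(sF, xi, ..., xi) the n positions of sF are absorbed and 1 / (n - 1)! remains in front of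
  a sum over shuffles into r = n - 1 blocks, one for each copy of xi.
  The shuffles are the lists of r disjoint nonempty index sets. The symmetric group S_r permutes these
  lists freely, and since F is graded symmetric and xi has degree 0, the Koszul sign picked up by
  exchanging two neighbouring blocks cancels against the one coming from F. So the sum is r! times
  the sum over the lists with increasing minima, which are the shuffles in the differential identity;
  characteristic 0 is needed to cancel r!.
*)
theory Submission
  imports Defs "HOL-Combinatorics.Multiset_Permutations"
begin

text \<open>Exchanging two blocks of different lengths changes the list of arities, so the symmetric
  group does not act on the shuffles of one given type. The sums over arities and over shuffles
  therefore merge into a single sum over lists of index blocks before orbits are formed; the arities
  survive as block lengths. Signs are attached to words of indices for the same reason: an exchange
  of blocks is a rearrangement of a word. The binary operation is a bracket and not an instance of
  the formula for the higher ones, yet it fits the pattern: one half of it is the case of a single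
  block, the other half is the subtracted sum of the differential identity. The operations are
  multilinear extensions, whereas the identities speak of homogeneous arguments. The extension
  cannot see its formula at a zero argument, so vanishing there is checked separately.\<close>

section \<open>Koszul signs of words of indices\<close>

text \<open>A permutation \<open>\<sigma>\<close> is encoded as the word \<open>[\<sigma> 0, \<dots>, \<sigma> (n - 1)]\<close>, so that signs can be split along
  concatenations.\<close>

definition cross_sign :: "int list \<Rightarrow> nat list \<Rightarrow> nat list \<Rightarrow> 'k::field" where
  "cross_sign es u v = (\<Prod>a\<leftarrow>u. \<Prod>b\<leftarrow>v. if b < a then (-1) powi (es ! a * es ! b) else 1)"

fun word_sign :: "int list \<Rightarrow> nat list \<Rightarrow> 'k::field" where
  "word_sign es [] = 1"
| "word_sign es (a # w) = cross_sign es [a] w * word_sign es w"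

lemma cross_sign_Nil_left [simp]: "cross_sign es [] v = 1"
  by (simp add: cross_sign_def)

lemma cross_sign_Nil_right [simp]:
  "cross_sign es u [] = 1"
  by (induction u) (simp_all add: cross_sign_def)

lemma cross_sign_append_left:
  "cross_sign es (u @ u') v = cross_sign es u v * cross_sign es u' v"
  by (simp add: cross_sign_def)

lemma cross_sign_append_right:
  "cross_sign es u (v @ v') = cross_sign es u v * cross_sign es u v'"
  by (induction u) (simp_all add: cross_sign_def mult_ac)

text \<open>Inversions of a concatenation lie in one of the two words or have one letter in each;
  the last kind is what \<open>cross_sign\<close> records.\<close>

lemma word_sign_append:
  "word_sign es (u @ v) = word_sign es u * word_sign es v * cross_sign es u v"
proof (induction u)
  case (Cons a u)
  have "cross_sign es (a # u) v = (cross_sign es [a] v * cross_sign es u v :: 'a)"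
    using cross_sign_append_left[of es "[a]" u v] by simp
  with Cons show ?case by (simp add: cross_sign_append_right mult_ac)
qed simp

lemma minus_one_powi_add: "(-1 :: 'k::field) powi (m + n) = (-1) powi m * (-1) powi n"
  by (simp add: power_int_add)

lemma minus_one_powi_square: "(-1 :: 'k::field) powi m * (-1) powi m = 1"
  by simp

text \<open>Letters of disjoint words are never equal, so each pair is inverted in exactly one of
  the two orders. The two cross signs together use every pair once, and signs are their own
  inverses.\<close>

lemma cross_sign_swap:
  assumes "set u \<inter> set v = {}"
  shows "cross_sign es u v =
    ((-1) powi (sum_list (map ((!) es) u) * sum_list (map ((!) es) v)) * cross_sign es v u :: 'k::field)"
  using assms
proof (induction u)
  case (Cons a u)
  have single: "cross_sign es [a] v =
      ((-1) powi (es ! a * sum_list (map ((!) es) v)) * cross_sign es v [a] :: 'k)"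
    if "a \<notin> set v" for v
    using that
  proof (induction v)
    case (Cons b v)
    have "cross_sign es [a] (b # v) = (cross_sign es [a] [b] * cross_sign es [a] v :: 'k)"
      using cross_sign_append_right[of es "[a]" "[b]" v] by simp
    moreover have "cross_sign es (b # v) [a] = (cross_sign es [b] [a] * cross_sign es v [a] :: 'k)"
      using cross_sign_append_left[of es "[b]" v "[a]"] by simp
    moreover have "cross_sign es [a] [b] = ((-1) powi (es ! a * es ! b) * cross_sign es [b] [a] :: 'k)"
      using Cons.prems by (auto simp: cross_sign_def minus_one_powi_square mult.commute)
    ultimately show ?case using Cons
      by (simp add: distrib_left minus_one_powi_add mult_ac)
  qed simp
  have "cross_sign es (a # u) v = (cross_sign es [a] v * cross_sign es u v :: 'k)"
    using cross_sign_append_left[of es "[a]" u v] by simp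
  moreover have "cross_sign es v (a # u) = (cross_sign es v [a] * cross_sign es v u :: 'k)"
    using cross_sign_append_right[of es v "[a]" u] by simp
  ultimately show ?case using Cons single[of v]
    by (simp add: distrib_right distrib_left minus_one_powi_add mult_ac)
qed simp

text \<open>Only the pairs with one index in each block change their order, so the factor is the
  Koszul sign for two elements of the total degrees of the blocks.\<close>

lemma word_sign_swap_blocks:
  assumes "set a \<inter> set b = {}"
  shows "word_sign es (u @ a @ b @ v) =
    ((-1) powi (sum_list (map ((!) es) a) * sum_list (map ((!) es) b))
      * word_sign es (u @ b @ a @ v) :: 'k::field)"
  using cross_sign_swap[OF assms, of es, where 'k='k]
  by (simp add: word_sign_append cross_sign_append_left cross_sign_append_right mult_ac)

lemma word_sign_map_upt:
  "word_sign es (map g [m..<n]) =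
    (\<Prod>i\<in>{m..<n}. \<Prod>j\<in>{i<..<n}. if g j < g i then (-1) powi (es ! g i * es ! g j) else 1)"
proof (induction "n - m" arbitrary: m)
  case (Suc k)
  then have "m < n" by simp
  have "cross_sign es [g m] (map g [Suc m..<n]) =
      (\<Prod>j\<in>{m<..<n}. if g j < g m then (-1) powi (es ! g m * es ! g j) else (1 :: 'a))"
    by (simp add: cross_sign_def o_def
        flip: prod.distinct_set_conv_list atLeastSucLessThan_greaterThanLessThan)
  with Suc \<open>m < n\<close> show ?case
    by (simp add: upt_conv_Cons prod.atLeast_Suc_lessThan)
qed simp

text \<open>Pairs of positions in order get the factor 1, which turns the product over inversions
  into one over the triangle \<open>i < j\<close>; its rows are the cross signs of a letter with the
  rest of the word.\<close>

lemma koszul_eq_word_sign: "koszul es \<sigma> = word_sign es (map \<sigma> [0..<length es])"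
proof -
  let ?n = "length es"
  let ?c = "\<lambda>i j. (-1) powi (es ! \<sigma> i * es ! \<sigma> j) :: 'a"
  have "koszul es \<sigma> = (\<Prod>(i, j)\<in>Sigma {0..<?n} (\<lambda>i. {i<..<?n}). if \<sigma> j < \<sigma> i then ?c i j else 1)"
    unfolding koszul_def
    by (rule prod.mono_neutral_cong_left) (auto split: if_splits)
  then show ?thesis
    by (simp add: word_sign_map_upt prod.Sigma)
qed

section \<open>Shuffles as lists of disjoint blocks\<close>

fun blocks :: "nat list \<Rightarrow> 'a list \<Rightarrow> 'a list list" where
  "blocks [] w = []"
| "blocks (k # ks) w = take k w # blocks ks (drop k w)"

lemma length_blocks [simp]: "length (blocks ks w) = length ks"
  by (induction ks arbitrary: w) auto

lemma nth_blocks: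
  "i < length ks \<Longrightarrow> blocks ks w ! i = take (ks ! i) (drop (sum_list (take i ks)) w)"
proof (induction ks arbitrary: i w)
  case (Cons k ks)
  then show ?case by (cases i) (auto simp: add.commute)
qed simp

lemma concat_blocks: "concat (blocks ks w) = take (sum_list ks) w"
  by (induction ks arbitrary: w) (auto simp: take_add)

lemma map_length_blocks: "sum_list ks \<le> length w \<Longrightarrow> map length (blocks ks w) = ks"
  by (induction ks arbitrary: w) auto

lemma blocks_concat: "blocks (map length Bs) (concat Bs @ R) = Bs"
  by (induction Bs) auto

text \<open>On the diagonal all factors other than identities are the same map. Evaluation is then a
  \<open>map\<close> over the blocks, so permuting blocks permutes the arguments of the outer
  map.\<close>

lemma tensor_val_blocks:
  "tensor_val (map (\<lambda>m. (m, \<phi>)) ks) xs = map \<phi> (blocks ks xs) @ drop (sum_list ks) xs"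
  by (induction ks arbitrary: xs) (auto simp: add.commute)

lemma blocks_map: "blocks ks (map f w) = map (map f) (blocks ks w)"
  by (induction ks arbitrary: w) (auto simp: take_map drop_map)

lemma strict_mono_on_iff_sorted_wrt:
  fixes f :: "nat \<Rightarrow> nat"
  shows "strict_mono_on {a..<b} f \<longleftrightarrow> sorted_wrt (<) (map f [a..<b])"
proof -
  have "sorted_wrt (<) (map f [a..<b]) \<longleftrightarrow> (\<forall>i j. i < j \<longrightarrow> j < b - a \<longrightarrow> f (a + i) < f (a + j))"
    by (auto simp: sorted_wrt_iff_nth_less)
  also have "\<dots> \<longleftrightarrow> strict_mono_on {a..<b} f"
  proof
    assume *: "\<forall>i j. i < j \<longrightarrow> j < b - a \<longrightarrow> f (a + i) < f (a + j)"
    show "strict_mono_on {a..<b} f"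
    proof (rule strict_mono_onI)
      fix r s assume "r \<in> {a..<b}" "s \<in> {a..<b}" "r < s"
      then show "f r < f s"
        using *[rule_format, of "r - a" "s - a"] by auto
    qed
  next
    assume *: "strict_mono_on {a..<b} f"
    show "\<forall>i j. i < j \<longrightarrow> j < b - a \<longrightarrow> f (a + i) < f (a + j)"
    proof (intro allI impI)
      fix i j assume "i < j" "j < b - a"
      then show "f (a + i) < f (a + j)" by (intro strict_mono_onD[OF *]) simp_all
    qed
  qed
  finally show ?thesis ..
qed

lemma Sh_iff_blocks:
  "\<tau> \<in> Sh ks \<longleftrightarrow> \<tau> permutes {..<sum_list ks} \<and>
     (\<forall>B \<in> set (blocks ks (map \<tau> [0..<sum_list ks])). sorted_wrt (<) B)"
proof -
  have "strict_mono_on {sum_list (take k ks)..<sum_list (take (Suc k) ks)} \<tau> \<longleftrightarrow>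
      sorted_wrt (<) (blocks ks (map \<tau> [0..<sum_list ks]) ! k)" if "k < length ks" for k
  proof -
    have *: "sum_list (take (Suc k) ks) = sum_list (take k ks) + ks ! k"
      using that by (simp add: take_Suc_conv_app_nth)
    have "sum_list (take (Suc k) ks) + sum_list (drop (Suc k) ks) = sum_list ks"
      by (metis append_take_drop_id sum_list_append)
    then have "sum_list (take k ks) + ks ! k \<le> sum_list ks" using * by linarith
    then show ?thesis
      using that by (simp add: nth_blocks strict_mono_on_iff_sorted_wrt * drop_map take_map)
  qed
  then show ?thesis
    by (auto simp: Sh_def all_set_conv_all_nth)
qed

text \<open>The last block of a shuffle, fed to the identity factors, may be empty and is determined by the
  others; it is not part of the list.\<close>

definition index_blocks :: "nat \<Rightarrow> nat \<Rightarrow> nat list list set" where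
  "index_blocks r N = {Bs. length Bs = r \<and> (\<forall>B \<in> set Bs. B \<noteq> [] \<and> sorted_wrt (<) B) \<and>
     distinct (concat Bs) \<and> set (concat Bs) \<subseteq> {..<N}}"

definition rest_block :: "nat \<Rightarrow> nat list list \<Rightarrow> nat list" where
  "rest_block N Bs = sorted_list_of_set ({..<N} - set (concat Bs))"

text \<open>The index set of the sum over \<open>ks\<close> in \<open>higher_op\<close>, for
  \<open>r\<close> inputs from \<open>A\<close> and \<open>N\<close> arguments. The total is only
  bounded, since the remaining arguments go to the identity factors.\<close>

definition arity_lists :: "nat \<Rightarrow> nat \<Rightarrow> nat list set" where
  "arity_lists r N = {ks. length ks = r \<and> (\<forall>k \<in> set ks. 1 \<le> k) \<and> sum_list ks \<le> N}"

lemma finite_arity_lists: "finite (arity_lists r N)"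
proof (rule finite_subset)
  show "arity_lists r N \<subseteq> {ks. set ks \<subseteq> {..N} \<and> length ks = r}"
    using member_le_sum_list by (fastforce simp: arity_lists_def)
  show "finite {ks. set ks \<subseteq> {..N} \<and> length ks = r}"
    by (rule finite_lists_length_eq) simp
qed

lemma finite_Sh: "finite (Sh ks)"
  by (rule finite_subset[OF _ finite_permutations[of "{..<sum_list ks}"]]) (auto simp: Sh_def)

text \<open>Inverse of the encoding of a permutation as a word. Beyond the word it is the identity,
  as \<open>permutes\<close> demands.\<close>

definition word_perm :: "nat list \<Rightarrow> nat \<Rightarrow> nat" where
  "word_perm w i = (if i < length w then w ! i else i)"

lemma map_word_perm: "map (word_perm w) [0..<length w] = w"
  by (rule nth_equalityI) (auto simp: word_perm_def)

lemma word_perm_permutes: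
  assumes "distinct w" "set w = {..<N}"
  shows "word_perm w permutes {..<N}"
proof (rule bij_imp_permutes)
  have N: "length w = N" using assms distinct_card[of w] by simp
  have "bij_betw ((!) w) {..<length w} (set w)"
    by (rule bij_betw_nth) (auto simp: assms)
  then have "bij_betw ((!) w) {..<N} {..<N}" by (simp add: N assms)
  then show "bij_betw (word_perm w) {..<N} {..<N}"
    by (rule bij_betw_cong[THEN iffD1, rotated]) (simp add: word_perm_def N)
  show "word_perm w x = x" if "x \<notin> {..<N}" for x
    using that N by (simp add: word_perm_def)
qed

lemma word_perm_map:
  assumes "\<tau> permutes {..<N}"
  shows "word_perm (map \<tau> [0..<N]) = \<tau>"
  using permutes_not_in[OF assms] by (fastforce simp: word_perm_def)

lemma distinct_map_permutes:
  assumes "\<tau> permutes {..<N}"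
  shows "distinct (map \<tau> [0..<N])" "set (map \<tau> [0..<N]) = {..<N}"
  using permutes_inj_on[OF assms, of "{0..<N}"] permutes_image[OF assms]
  by (auto simp: distinct_map lessThan_atLeast0)

text \<open>An increasing list is determined by its set, and here the set is the complement of the
  other blocks.\<close>

lemma drop_eq_rest_block:
  assumes "w = concat Bs @ R" "distinct w" "set w = {..<N}" "sorted_wrt (<) R"
  shows "R = rest_block N Bs"
proof -
  have "set R = {..<N} - set (concat Bs)" using assms by auto
  then show ?thesis unfolding rest_block_def
    by (metis assms(4) strict_sorted_equal sorted_list_of_set.sorted_sorted_key_list_of_set
        strict_sorted_list_of_set set_sorted_list_of_set finite_Diff finite_lessThan)
qed

lemma Sh_rest_block:
  assumes "ks \<in> arity_lists r N" "\<tau> \<in> Sh (rev ks @ [N - sum_list ks])"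
  defines "w \<equiv> map \<tau> [0..<N]"
  shows "blocks (rev ks) w \<in> index_blocks r N"
    and "drop (sum_list ks) w = rest_block N (blocks (rev ks) w)"
    and "concat (blocks (rev ks) w) @ rest_block N (blocks (rev ks) w) = w"
    and "\<tau> permutes {..<N}"
proof -
  have le: "sum_list ks \<le> N" and r: "length ks = r" and pos: "\<forall>k\<in>set ks. 1 \<le> k"
    using assms by (auto simp: arity_lists_def)
  \<comment> \<open>\<open>blocks\<close> drops what exceeds the given sizes, so the last block is
    listed with its own size; only then does \<open>Sh_iff_blocks\<close> show that it
    increases.\<close>
  have split: "blocks (rev ks @ [N - sum_list ks]) w = blocks (rev ks) w @ [drop (sum_list ks) w]"
  proof -
    have "blocks (ls @ [N - sum_list ks]) v = blocks ls v @ [take (N - sum_list ks) (drop (sum_list ls) v)]"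
      for ls and v :: "nat list"
      by (induction ls arbitrary: v) (auto simp: add.commute)
    then show ?thesis by (simp add: w_def)
  qed
  have \<tau>: "\<tau> permutes {..<N}"
    and inc: "\<forall>B \<in> set (blocks (rev ks @ [N - sum_list ks]) w). sorted_wrt (<) B"
    using assms(2) le by (simp_all add: Sh_iff_blocks w_def)
  note dw = distinct_map_permutes[OF \<tau>, folded w_def]
  have cat: "concat (blocks (rev ks) w) @ drop (sum_list ks) w = w"
    by (simp add: concat_blocks)
  show rest: "drop (sum_list ks) w = rest_block N (blocks (rev ks) w)"
    by (rule drop_eq_rest_block[OF cat[symmetric] dw]) (use inc split in auto)
  show "concat (blocks (rev ks) w) @ rest_block N (blocks (rev ks) w) = w"
    using cat rest by simp
  have "B \<noteq> []" if "B \<in> set (blocks (rev ks) w)" for B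
  proof -
    have "length B \<in> set (map length (blocks (rev ks) w))" using that by auto
    also have "map length (blocks (rev ks) w) = rev ks"
      by (rule map_length_blocks) (simp add: w_def le)
    finally show ?thesis using pos by auto
  qed
  moreover have "distinct (concat (blocks (rev ks) w))" "set (concat (blocks (rev ks) w)) \<subseteq> {..<N}"
    unfolding concat_blocks using dw by (auto dest: in_set_takeD)
  ultimately show "blocks (rev ks) w \<in> index_blocks r N"
    using inc split r by (auto simp: index_blocks_def)
  show "\<tau> permutes {..<N}" by (fact \<tau>)
qed

text \<open>Both components of the pair can be read off the blocks: the arities are the block
  lengths, in reverse order because the block of the last input comes first, and the word of the
  shuffle is the concatenation followed by the remaining indices in increasing order.\<close>

lemma bij_betw_shuffle_blocks:
  "bij_betw (\<lambda>(ks, \<tau>). blocks (rev ks) (map \<tau> [0..<N]))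
     (SIGMA ks : arity_lists r N. Sh (rev ks @ [N - sum_list ks])) (index_blocks r N)"
proof (rule bij_betw_byWitness[where f' =
      "\<lambda>Bs. (rev (map length Bs), word_perm (concat Bs @ rest_block N Bs))"], goal_cases)
  case 1
  show ?case
  proof clarsimp
    fix ks \<tau> assume ks: "ks \<in> arity_lists r N" "\<tau> \<in> Sh (rev ks @ [N - sum_list ks])"
    then have "map length (blocks (rev ks) (map \<tau> [0..<N])) = rev ks"
      by (intro map_length_blocks) (simp add: arity_lists_def)
    with Sh_rest_block[OF ks] show "rev (map length (blocks (rev ks) (map \<tau> [0..<N]))) = ks \<and>
       word_perm (concat (blocks (rev ks) (map \<tau> [0..<N])) @
         rest_block N (blocks (rev ks) (map \<tau> [0..<N]))) = \<tau>"
      by (simp add: word_perm_map)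
  qed
next
  have main: "(rev (map length Bs), word_perm (concat Bs @ rest_block N Bs)) \<in>
        (SIGMA ks : arity_lists r N. Sh (rev ks @ [N - sum_list ks]))"
      "blocks (map length Bs) (map (word_perm (concat Bs @ rest_block N Bs)) [0..<N]) = Bs"
    if "Bs \<in> index_blocks r N" for Bs
  proof -
    define w where "w = concat Bs @ rest_block N Bs"
    have Bs: "length Bs = r" "\<forall>B \<in> set Bs. B \<noteq> [] \<and> sorted_wrt (<) B" "distinct (concat Bs)"
      "set (concat Bs) \<subseteq> {..<N}"
      using that by (auto simp: index_blocks_def)
    have w: "distinct w" "set w = {..<N}"
      using Bs by (auto simp: w_def rest_block_def)
    then have N: "length w = N" using distinct_card[of w] by simp
    have len: "sum_list (map length Bs) = length (concat Bs)" by (simp add: length_concat)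
    have le: "length (concat Bs) \<le> N" using N by (simp add: w_def)
    have word: "map (word_perm w) [0..<N] = w" using map_word_perm[of w] N by simp
    have "length (rest_block N Bs) = N - length (concat Bs)" using N by (simp add: w_def)
    then have "blocks (map length Bs @ [N - length (concat Bs)]) w = Bs @ [rest_block N Bs]"
      using blocks_concat[of "Bs @ [rest_block N Bs]" "[]"] by (simp add: w_def)
    moreover have "sorted_wrt (<) (rest_block N Bs)"
      by (simp add: rest_block_def)
    ultimately have "word_perm w \<in> Sh (map length Bs @ [N - length (concat Bs)])"
      unfolding Sh_iff_blocks using word_perm_permutes[OF w] Bs(2) le word len by auto
    moreover have "rev (map length Bs) \<in> arity_lists r N"
      using Bs le len by (auto simp: arity_lists_def Suc_le_eq)
    ultimately show "(rev (map length Bs), word_perm (concat Bs @ rest_block N Bs)) \<in>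
        (SIGMA ks : arity_lists r N. Sh (rev ks @ [N - sum_list ks]))"
      by (simp add: len w_def)
    show "blocks (map length Bs) (map (word_perm (concat Bs @ rest_block N Bs)) [0..<N]) = Bs"
      using word blocks_concat[of Bs "rest_block N Bs"] by (simp add: w_def)
  qed
  case 2
  show ?case using main(2) by auto
  case 3
  show ?case using Sh_rest_block(1) by auto
  case 4
  show ?case using main(1) by blast
qed

lemma sum_shuffles_eq_sum_blocks:
  "(\<Sum>ks \<in> arity_lists r N. \<Sum>\<tau> \<in> Sh (rev ks @ [N - sum_list ks]). f (blocks (rev ks) (map \<tau> [0..<N])))
     = (\<Sum>Bs \<in> index_blocks r N. f Bs)"
  by (subst sum.Sigma)
     (use sum.reindex_bij_betw[OF bij_betw_shuffle_blocks, of f N r]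
       in \<open>auto simp: finite_arity_lists finite_Sh split_def\<close>)

lemma finite_index_blocks: "finite (index_blocks r N)"
  using bij_betw_finite[OF bij_betw_shuffle_blocks] by (simp add: finite_arity_lists finite_Sh)

section \<open>Sums of symmetric functions over lists\<close>

text \<open>Adjacent transpositions generate the symmetric group. In the induction the head of
  \<open>xs\<close> moves to the front of \<open>ys\<close> by adjacent swaps; with this head kept
  in place, the function of the remaining list again satisfies the hypothesis, which is why
  \<open>T\<close> is generalized.\<close>

lemma eq_if_adjacent_swaps:
  assumes "\<And>us x y vs. mset (us @ x # y # vs) = mset xs \<Longrightarrow> T (us @ x # y # vs) = T (us @ y # x # vs)"
    and "mset ys = mset xs"
  shows "T ys = T xs"
  using assms
proof (induction xs arbitrary: T ys)
  case (Cons x xs)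
  from Cons.prems(2) obtain us vs where ys: "ys = us @ x # vs"
    by (metis in_set_conv_decomp list.set_intros(1) set_mset_mset)
  have eq: "mset (us @ vs) = mset xs" using Cons.prems(2) ys by simp
  have "T (us @ x # vs) = T (x # us @ vs)" if "mset (us @ x # vs) = mset (x # xs)" for us vs
    using that
  proof (induction us arbitrary: vs rule: rev_induct)
    case (snoc u us)
    have "T (us @ u # x # vs) = T (us @ x # u # vs)"
      by (rule Cons.prems(1)) (use snoc.prems in simp)
    with snoc show ?case by simp
  qed simp
  then have "T ys = T (x # us @ vs)" using ys Cons.prems(2) by simp
  also have "\<dots> = T (x # xs)"
  proof (rule Cons.IH[of "\<lambda>zs. T (x # zs)", OF _ eq])
    fix us' a b vs' assume "mset (us' @ a # b # vs') = mset xs"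
    then show "T (x # us' @ a # b # vs') = T (x # us' @ b # a # vs')"
      using Cons.prems(1)[of "x # us'" a b vs'] by simp
  qed
  finally show ?case .
qed simp

context vector_space
begin

text \<open>Each fibre of \<open>sort_key key\<close> consists of the \<open>r!\<close> orderings of one list.\<close>

lemma sum_eq_fact_scale_sum_sorted:
  fixes key :: "'c \<Rightarrow> 'd::linorder" and T :: "'c list \<Rightarrow> 'b"
  assumes "finite S"
    and S: "\<And>Bs. Bs \<in> S \<Longrightarrow> length Bs = r \<and> distinct Bs \<and> inj_on key (set Bs)"
    and closed: "\<And>Bs Cs. Bs \<in> S \<Longrightarrow> mset Cs = mset Bs \<Longrightarrow> Cs \<in> S"
    and T: "\<And>Bs Cs. Bs \<in> S \<Longrightarrow> mset Cs = mset Bs \<Longrightarrow> T Cs = T Bs"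
  shows "(\<Sum>Bs\<in>S. T Bs) = scale (of_nat (fact r)) (\<Sum>Bs | Bs \<in> S \<and> sorted (map key Bs). T Bs)"
proof -
  let ?S' = "{Bs \<in> S. sorted (map key Bs)}"
  have "(\<Sum>Bs\<in>S. T Bs) = (\<Sum>Cs\<in>?S'. \<Sum>Bs | Bs \<in> S \<and> sort_key key Bs = Cs. T Bs)"
    by (rule sum.group[symmetric]) (use \<open>finite S\<close> closed in auto)
  also have "\<dots> = (\<Sum>Cs\<in>?S'. scale (of_nat (fact r)) (T Cs))"
  proof (rule sum.cong[OF refl])
    fix Cs assume "Cs \<in> ?S'"
    then have Cs: "Cs \<in> S" "sorted (map key Cs)" by auto
    have "{Bs \<in> S. sort_key key Bs = Cs} = permutations_of_set (set Cs)"
    proof (intro equalityI subsetI)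
      fix Bs assume "Bs \<in> {Bs \<in> S. sort_key key Bs = Cs}"
      then show "Bs \<in> permutations_of_set (set Cs)"
        using S by (auto simp: permutations_of_set_def)
    next
      fix Bs assume "Bs \<in> permutations_of_set (set Cs)"
      then have "mset Bs = mset Cs"
        using S[OF Cs(1)] set_eq_iff_mset_eq_distinct[of Bs Cs]
        by (simp add: permutations_of_set_def)
      then show "Bs \<in> {Bs \<in> S. sort_key key Bs = Cs}"
        using closed[OF Cs(1)] S Cs sort_key_inj_key_eq[of Bs Cs key] by auto
    qed
    moreover have "card (permutations_of_set (set Cs)) = fact r"
      using S[OF Cs(1)] by (simp add: distinct_card)
    moreover have "T Bs = T Cs" if "Bs \<in> S" "sort_key key Bs = Cs" for Bs
      using T[OF Cs(1), of Bs] that mset_sort[of key Bs] by metis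
    then have "(\<Sum>Bs | Bs \<in> S \<and> sort_key key Bs = Cs. T Bs) =
        (\<Sum>Bs | Bs \<in> S \<and> sort_key key Bs = Cs. T Cs)"
      by (intro sum.cong) auto
    ultimately show "(\<Sum>Bs | Bs \<in> S \<and> sort_key key Bs = Cs. T Bs) = scale (of_nat (fact r)) (T Cs)"
      by (simp add: sum_constant_scale)
  qed
  finally show ?thesis by (simp add: scale_sum_right)
qed

end

lemma index_blocks_mset:
  assumes "Bs \<in> index_blocks r N" "mset Cs = mset Bs"
  shows "Cs \<in> index_blocks r N" "rest_block N Cs = rest_block N Bs"
proof -
  have "mset (concat Cs) = mset (concat Bs)"
    using assms(2) by (metis mset_concat mset_map sum_mset_sum_list)
  moreover from this have "set (concat Cs) = set (concat Bs)" by (rule mset_eq_setD)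
  ultimately show "Cs \<in> index_blocks r N" "rest_block N Cs = rest_block N Bs"
    using assms mset_eq_length[OF assms(2)] mset_eq_setD[OF assms(2)] mset_eq_imp_distinct_iff
    unfolding index_blocks_def rest_block_def by auto
qed

text \<open>Blocks are disjoint and nonempty, so no two share their first entry, which is the
  minimum since blocks increase. This makes \<open>hd\<close> a key that singles out one ordering of
  each block list.\<close>

lemma index_blocks_hd:
  assumes "Bs \<in> index_blocks r N"
  shows "length Bs = r \<and> distinct Bs \<and> inj_on hd (set Bs)"
proof -
  have ne: "B \<noteq> []" if "B \<in> set Bs" for B using assms that by (auto simp: index_blocks_def)
  have "distinct (concat Bs)" using assms by (simp add: index_blocks_def)
  then have "distinct (map hd Bs)" using ne
  proof (induction Bs)
    case (Cons B Bs)
    have "hd B \<noteq> hd C" if "C \<in> set Bs" for C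
    proof -
      have "hd B \<in> set B" "hd C \<in> set C" using Cons.prems that by auto
      with Cons.prems that show ?thesis by fastforce
    qed
    with Cons show ?case by auto
  qed simp
  then show ?thesis using assms by (auto simp: distinct_map index_blocks_def)
qed

lemma sum_increasing_shuffles_eq_sum_blocks:
  "(\<Sum>ks \<in> arity_lists r N.
      \<Sum>\<tau> | \<tau> \<in> Sh (rev ks @ [N - sum_list ks]) \<and>
            strict_mono_on {..<r} (\<lambda>k. \<tau> (sum_list (take k (rev ks)))).
      f (blocks (rev ks) (map \<tau> [0..<N])))
     = (\<Sum>Bs | Bs \<in> index_blocks r N \<and> sorted (map hd Bs). f Bs)"
proof -
  have *: "strict_mono_on {..<r} (\<lambda>k. \<tau> (sum_list (take k (rev ks)))) \<longleftrightarrow>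
      sorted (map hd (blocks (rev ks) (map \<tau> [0..<N])))"
    if ks: "ks \<in> arity_lists r N" and \<tau>: "\<tau> \<in> Sh (rev ks @ [N - sum_list ks])" for ks \<tau>
  proof -
    let ?Bs = "blocks (rev ks) (map \<tau> [0..<N])"
    have hd: "hd (?Bs ! k) = \<tau> (sum_list (take k (rev ks)))" if "k < r" for k
    proof -
      have k: "k < length (rev ks)" using that ks by (simp add: arity_lists_def)
      have "rev ks ! k \<in> set ks" using k nth_mem[OF k] by simp
      then have pos: "rev ks ! k > 0" using ks by (auto simp: arity_lists_def Suc_le_eq)
      have "sum_list (take (Suc k) (rev ks)) + sum_list (drop (Suc k) (rev ks)) = sum_list ks"
        by (metis append_take_drop_id sum_list_append sum_list_rev)
      then have "sum_list (take k (rev ks)) + rev ks ! k \<le> N"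
        using ks k by (simp add: take_Suc_conv_app_nth arity_lists_def)
      then show ?thesis using pos k
        by (simp add: nth_blocks hd_take hd_drop_conv_nth)
    qed
    have B: "length ?Bs = r" "distinct ?Bs" "inj_on hd (set ?Bs)"
      using index_blocks_hd[OF Sh_rest_block(1)[OF ks \<tau>]] by auto
    \<comment> \<open>Distinct heads make weak and strict order agree: the orbit argument sorts
      weakly, the differential identity asks for strict monotonicity.\<close>
    have "sorted (map hd ?Bs) \<longleftrightarrow> sorted_wrt (<) (map hd ?Bs)"
      using B by (simp add: strict_sorted_iff distinct_map)
    moreover have "map hd ?Bs = map (\<lambda>k. \<tau> (sum_list (take k (rev ks)))) [0..<r]"
      by (rule nth_equalityI) (use B hd in auto)
    ultimately show ?thesis
      by (simp only: strict_mono_on_iff_sorted_wrt lessThan_atLeast0)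
  qed
  \<comment> \<open>The condition moves into the summand as an indicator, so that the bijection for
    unrestricted shuffles applies.\<close>
  have "(\<Sum>\<tau> | \<tau> \<in> Sh (rev ks @ [N - sum_list ks]) \<and>
            strict_mono_on {..<r} (\<lambda>k. \<tau> (sum_list (take k (rev ks)))).
          f (blocks (rev ks) (map \<tau> [0..<N]))) =
      (\<Sum>\<tau> \<in> Sh (rev ks @ [N - sum_list ks]).
          (\<lambda>Bs. if sorted (map hd Bs) then f Bs else 0) (blocks (rev ks) (map \<tau> [0..<N])))"
    if "ks \<in> arity_lists r N" for ks
    by (rule sum.mono_neutral_cong_left) (use * that in \<open>auto simp: finite_Sh\<close>)
  then have "(\<Sum>ks \<in> arity_lists r N.
      \<Sum>\<tau> | \<tau> \<in> Sh (rev ks @ [N - sum_list ks]) \<and>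
            strict_mono_on {..<r} (\<lambda>k. \<tau> (sum_list (take k (rev ks)))).
      f (blocks (rev ks) (map \<tau> [0..<N]))) =
    (\<Sum>Bs\<in>index_blocks r N. if sorted (map hd Bs) then f Bs else 0)"
    using sum_shuffles_eq_sum_blocks[of "\<lambda>Bs. if sorted (map hd Bs) then f Bs else 0" N r] by simp
  then show ?thesis
    by (simp add: sum.If_cases finite_index_blocks Int_def)
qed

section \<open>Graded symmetric maps\<close>

lemma listset_iff: "xs \<in> listset As \<longleftrightarrow> list_all2 (\<in>) xs As"
  by (induction As arbitrary: xs) (auto simp: set_Cons_def list_all2_Cons2)

lemma homog_lengthD: "homog V es xs \<Longrightarrow> length es = length xs"
  by (simp add: homog_def list_all2_lengthD)

lemma homog_nthD: "homog V es xs \<Longrightarrow> i < length xs \<Longrightarrow> xs ! i \<in> V (es ! i)"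
  by (auto simp: homog_def list_all2_conv_all_nth)

lemma homog_map_nth:
  assumes "homog V es xs" "set w \<subseteq> {..<length xs}"
  shows "homog V (map ((!) es) w) (map ((!) xs) w)"
  using assms(2) homog_nthD[OF assms(1)] by (auto simp: homog_def list_all2_conv_all_nth subset_iff)

lemma permute_list_eq_map: "permute_list \<sigma> xs = map ((!) xs) (map \<sigma> [0..<length xs])"
  by (simp add: permute_list_def)

lemma koszul_transpose:
  assumes "Suc i < length es"
  shows "koszul es (transpose i (Suc i)) = (-1) powi (es ! i * es ! Suc i)"
proof -
  have "{(a, b). a < b \<and> b < length es \<and> transpose i (Suc i) b < transpose i (Suc i) a} = {(i, Suc i)}"
    using assms by (auto simp: transpose_def split: if_splits)
  then show ?thesis by (simp add: koszul_def mult.commute)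
qed

context graded_vector_space
begin

lemma hcomp_unique:
  assumes "\<And>d. c d \<in> V d" "finite {d. c d \<noteq> 0}" "x = (\<Sum>d | c d \<noteq> 0. c d)"
  shows "hcomp V x = c"
  unfolding hcomp_def by (rule the1_equality[OF decomposition]) (use assms in auto)

lemma hcomp_in: "hcomp V x d \<in> V d"
  and finite_hcomp: "finite {d. hcomp V x d \<noteq> 0}"
  using theI'[OF decomposition[of x]] unfolding hcomp_def by auto

lemma hcomp_homogeneous:
  assumes "x \<in> V e"
  shows "hcomp V x = (\<lambda>d. if d = e then x else 0)"
proof (rule hcomp_unique)
  have "{d. (if d = e then x else 0) \<noteq> 0} = (if x = 0 then {} else {e})" by auto
  then show "x = (\<Sum>d | (if d = e then x else 0) \<noteq> 0. if d = e then x else 0)" by simp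
qed (use assms subspace_0[OF subspace_component] in auto)

lemma homog_hcomp:
  assumes "es \<in> listset (map (\<lambda>x. {d. hcomp V x d \<noteq> 0}) xs)"
  shows "homog V es (map2 (hcomp V) xs es)" "length (map2 (hcomp V) xs es) = length xs"
  using assms
  by (auto simp: listset_iff homog_def list_all2_conv_all_nth hcomp_in)

text \<open>Only homogeneous components are ever inserted into the formula, so facts that need
  degrees, such as graded symmetry, may be used beneath \<open>ml_ext\<close>.\<close>

lemma ml_ext_cong:
  assumes "\<And>es vs. length vs = length xs \<Longrightarrow> homog V es vs \<Longrightarrow> G es vs = H es vs"
  shows "ml_ext V G xs = ml_ext V H xs"
  unfolding ml_ext_def by (rule sum.cong[OF refl]) (use assms homog_hcomp in blast)

lemma ml_ext_sum: "ml_ext V (\<lambda>es vs. \<Sum>i\<in>A. G i es vs) xs = (\<Sum>i\<in>A. ml_ext V (G i) xs)"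
  unfolding ml_ext_def by (rule sum.swap)

lemma ml_ext_scale: "ml_ext V (\<lambda>es vs. scale a (G es vs)) xs = scale a (ml_ext V G xs)"
  by (simp add: ml_ext_def scale_sum_right)

lemma ml_ext_diff: "ml_ext V (\<lambda>es vs. G es vs - H es vs) xs = ml_ext V G xs - ml_ext V H xs"
  by (simp add: ml_ext_def sum_subtractf)

text \<open>A nonzero homogeneous element has a single nonzero component, so the sum defining
  \<open>ml_ext\<close> has exactly one term.\<close>

lemma ml_ext_homog:
  assumes "homog V es xs" "0 \<notin> set xs"
  shows "ml_ext V G xs = G es xs"
proof -
  have "listset (map (\<lambda>x. {d. hcomp V x d \<noteq> 0}) xs) = {es} \<and> map2 (hcomp V) xs es = xs"
    using assms unfolding homog_def
  proof (induction rule: list_all2_induct)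
    case (Cons e es x xs)
    then have "{d. hcomp V x d \<noteq> 0} = {e}" by (auto simp: hcomp_homogeneous)
    with Cons show ?case by (auto simp: set_Cons_def hcomp_homogeneous)
  qed simp
  then show ?thesis by (simp add: ml_ext_def)
qed

text \<open>A zero argument has an empty set of non-zero components, so there \<open>ml_ext\<close> does not see \<open>G\<close>.\<close>

lemma ml_ext_eq_0_iff:
  assumes "\<And>es xs. 0 \<in> set xs \<Longrightarrow> G es xs = 0"
  shows "(\<forall>xs. length xs = n \<longrightarrow> ml_ext V G xs = 0) \<longleftrightarrow>
    (\<forall>es xs. length xs = n \<and> homog V es xs \<longrightarrow> G es xs = 0)"
proof
  assume "\<forall>xs. length xs = n \<longrightarrow> ml_ext V G xs = 0"
  then show "\<forall>es xs. length xs = n \<and> homog V es xs \<longrightarrow> G es xs = 0"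
    using assms ml_ext_homog by metis
next
  assume *: "\<forall>es xs. length xs = n \<and> homog V es xs \<longrightarrow> G es xs = 0"
  have "ml_ext V G xs = ml_ext V (\<lambda>_ _. 0) xs" if "length xs = n" for xs
    by (rule ml_ext_cong) (use * that in auto)
  then show "\<forall>xs. length xs = n \<longrightarrow> ml_ext V G xs = 0" by (simp add: ml_ext_def)
qed

lemma Hom_Sbar_arity_part:
  assumes "F \<in> Hom_Sbar scale V p" "xs \<noteq> []"
  shows "arity_part (length xs) F \<in> Hom_Sym scale V (length xs) p"
  using assms by (auto simp: Hom_Sbar_def Suc_le_eq)

lemma Hom_Sbar_zero:
  assumes "F \<in> Hom_Sbar scale V p" "0 \<in> set xs"
  shows "F xs = 0"
proof -
  obtain i where i: "i < length xs" "xs ! i = 0" using assms(2) by (auto simp: in_set_conv_nth)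
  have "Vector_Spaces.linear scale scale (\<lambda>y. arity_part (length xs) F (xs[i := y]))"
    using Hom_Sbar_arity_part[OF assms(1), of xs] i by (cases "xs = []") (auto simp: Hom_Sym_def)
  then interpret lin: Vector_Spaces.linear scale scale "\<lambda>y. arity_part (length xs) F (xs[i := y])" .
  have "arity_part (length xs) F (xs[i := 0]) = 0" by (rule lin.zero)
  then show ?thesis using i by (metis arity_part_def list_update_id)
qed

lemma Hom_Sbar_degree:
  assumes "F \<in> Hom_Sbar scale V p" "homog V es xs" "xs \<noteq> []"
  shows "F xs \<in> V (sum_list es + p)"
  using Hom_Sbar_arity_part[OF assms(1,3)] assms(2) by (auto simp: Hom_Sym_def arity_part_def)

text \<open>Graded symmetry for an adjacent transposition, whose only inversion is the exchanged
  pair. The degrees are parameters, as elements do not determine them when they vanish.\<close>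

lemma Hom_Sbar_swap:
  assumes "F \<in> Hom_Sbar scale V p"
    and "homog V (ds @ d # e # ds') (us @ y # z # ws)" "length ds = length us"
  shows "F (us @ y # z # ws) = scale ((-1) powi (d * e)) (F (us @ z # y # ws))"
proof -
  let ?xs = "us @ y # z # ws" and ?es = "ds @ d # e # ds'" and ?i = "length us"
  let ?\<sigma> = "transpose ?i (Suc ?i)"
  have \<sigma>: "?\<sigma> permutes {..<length ?xs}"
    by (rule permutes_swap_id) auto
  then have "F ?xs = scale (koszul ?es ?\<sigma>) (F (permute_list ?\<sigma> ?xs))"
    using Hom_Sbar_arity_part[OF assms(1), of ?xs] assms(2) by (auto simp: Hom_Sym_def arity_part_def)
  moreover have "koszul ?es ?\<sigma> = ((-1) powi (d * e) :: 'k)"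
    using koszul_transpose[of ?i ?es] homog_lengthD[OF assms(2)] assms(3)
    by (simp add: nth_append)
  moreover have "permute_list ?\<sigma> ?xs = us @ z # y # ws"
  proof (rule nth_equalityI)
    fix j assume "j < length (permute_list ?\<sigma> ?xs)"
    then have j: "j < length ?xs" by simp
    consider "j < ?i" | "j = ?i" | "j = Suc ?i" | k where "j = Suc (Suc ?i) + k"
      by (metis le_add_diff_inverse linorder_neqE_nat not_less_eq Suc_leI)
    then show "permute_list ?\<sigma> ?xs ! j = (us @ z # y # ws) ! j"
      unfolding permute_list_nth[OF \<sigma> j] by cases (auto simp: nth_append transpose_def)
  qed simp
  ultimately show ?thesis by simp
qed

section \<open>Invariance of the summands under exchange of blocks\<close>

text \<open>The contribution of one shuffle, expressed by its blocks alone so that \<open>Bs\<close>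
  can be reordered. The power of \<open>lam\<close> is left out because it depends only on the
  number of blocks.\<close>

definition block_term ::
  "'v mmap \<Rightarrow> 'v mmap \<Rightarrow> int list \<Rightarrow> 'v list \<Rightarrow> nat list list \<Rightarrow> 'v" where
  "block_term F \<xi> es vs Bs =
     scale (word_sign es (concat Bs @ rest_block (length vs) Bs))
       (F (map (\<lambda>B. \<xi> (map ((!) vs) B)) Bs @ map ((!) vs) (rest_block (length vs) Bs)))"

text \<open>As \<xi> preserves degrees, its value on a block has the total degree of that block.
  Hence \<open>F\<close> and the word both produce the sign with exponent
  \<open>?deg B * ?deg C\<close>, whose square is 1.\<close>

lemma block_term_swap:
  assumes F: "F \<in> Hom_Sbar scale V p" and \<xi>: "\<xi> \<in> Hom_Sbar scale V 0"
    and vs: "homog V es vs"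
    and Bs: "us @ B # C # ws \<in> index_blocks r (length vs)"
  shows "block_term F \<xi> es vs (us @ B # C # ws) = block_term F \<xi> es vs (us @ C # B # ws)"
proof -
  let ?N = "length vs"
  let ?R = "rest_block ?N (us @ B # C # ws)"
  let ?deg = "\<lambda>B. sum_list (map ((!) es) B)"
  let ?val = "\<lambda>B. \<xi> (map ((!) vs) B)"
  have R: "rest_block ?N (us @ C # B # ws) = ?R"
    using index_blocks_mset(2)[OF Bs, of "us @ C # B # ws"] by simp
  have "set ?R \<subseteq> {..<?N}" by (auto simp: rest_block_def)
  have val: "?val A \<in> V (?deg A)" if "A \<in> set (us @ B # C # ws)" for A
  proof -
    have "set A \<subseteq> {..<?N}" "A \<noteq> []"
      using Bs that by (auto simp: index_blocks_def)
    then show ?thesis using Hom_Sbar_degree[OF \<xi> homog_map_nth[OF vs, of A]] by simp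
  qed
  have map_val: "homog V (map ?deg As) (map ?val As)" if "set As \<subseteq> set (us @ B # C # ws)" for As
    using that val by (auto simp: homog_def list_all2_conv_all_nth subset_iff)
  have "homog V (map ?deg (us @ B # C # ws) @ map ((!) es) ?R)
      (map ?val (us @ B # C # ws) @ map ((!) vs) ?R)"
    using map_val[OF subset_refl] homog_map_nth[OF vs \<open>set ?R \<subseteq> {..<?N}\<close>]
    unfolding homog_def by (rule list_all2_appendI)
  then have "F (map ?val (us @ B # C # ws) @ map ((!) vs) ?R) =
      scale ((-1) powi (?deg B * ?deg C)) (F (map ?val (us @ C # B # ws) @ map ((!) vs) ?R))"
    using Hom_Sbar_swap[OF F, of "map ?deg us" "?deg B" "?deg C" "map ?deg ws @ map ((!) es) ?R"
        "map ?val us" "?val B" "?val C" "map ?val ws @ map ((!) vs) ?R"] by simp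
  moreover have "word_sign es (concat (us @ B # C # ws) @ ?R) =
      ((-1) powi (?deg B * ?deg C) * word_sign es (concat (us @ C # B # ws) @ ?R) :: 'k)"
    using word_sign_swap_blocks[of B C es "concat us" "concat ws @ ?R"] Bs
    by (auto simp: index_blocks_def)
  ultimately show ?thesis
    by (simp add: block_term_def R minus_one_powi_square mult_ac flip: mult.assoc)
qed

lemma sum_block_term:
  assumes F: "F \<in> Hom_Sbar scale V p" and \<xi>: "\<xi> \<in> Hom_Sbar scale V 0" and vs: "homog V es vs"
  shows "(\<Sum>Bs \<in> index_blocks r (length vs). block_term F \<xi> es vs Bs) =
    scale (of_nat (fact r))
      (\<Sum>Bs | Bs \<in> index_blocks r (length vs) \<and> sorted (map hd Bs). block_term F \<xi> es vs Bs)"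
proof (rule sum_eq_fact_scale_sum_sorted)
  show "finite (index_blocks r (length vs))" by (fact finite_index_blocks)
  show "length Bs = r \<and> distinct Bs \<and> inj_on hd (set Bs)" if "Bs \<in> index_blocks r (length vs)" for Bs
    using that by (rule index_blocks_hd)
  show "Cs \<in> index_blocks r (length vs)"
    if "Bs \<in> index_blocks r (length vs)" "mset Cs = mset Bs" for Bs Cs
    using that by (rule index_blocks_mset(1))
  fix Bs Cs assume Bs: "Bs \<in> index_blocks r (length vs)" "mset Cs = mset Bs"
  show "block_term F \<xi> es vs Cs = block_term F \<xi> es vs Bs"
    by (rule eq_if_adjacent_swaps[OF _ Bs(2)])
       (rule block_term_swap[OF F \<xi> vs index_blocks_mset(1)[OF Bs(1)]])
qed

lemma shuffle_term_eq_block_term: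
  assumes "ks \<in> arity_lists r (length vs)" "\<tau> \<in> Sh (rev ks @ [length vs - sum_list ks])"
    and "length es = length vs"
  shows "scale (koszul es \<tau>) (F (tensor_val (map (\<lambda>m. (m, \<xi>)) (rev ks)) (permute_list \<tau> vs))) =
    block_term F \<xi> es vs (blocks (rev ks) (map \<tau> [0..<length vs]))"
proof -
  define w where "w = map \<tau> [0..<length vs]"
  have "tensor_val (map (\<lambda>m. (m, \<xi>)) (rev ks)) (permute_list \<tau> vs) =
      map (\<lambda>B. \<xi> (map ((!) vs) B)) (blocks (rev ks) w) @ map ((!) vs) (drop (sum_list ks) w)"
    unfolding permute_list_eq_map w_def[symmetric]
    by (simp add: tensor_val_blocks blocks_map drop_map)
  then show ?thesis
    using Sh_rest_block(2,3)[OF assms(1,2), folded w_def] assms(3)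
    by (simp add: block_term_def koszul_eq_word_sign flip: w_def)
qed

text \<open>The part of the first sum of the differential identity with \<open>p = r + 1\<close>,
  all values of \<open>t\<close> taken together; hence the exponent \<open>r - 1\<close> in place of
  \<open>p - 2\<close>.\<close>

definition increasing_sum ::
  "'k \<Rightarrow> 'v mmap \<Rightarrow> 'v mmap \<Rightarrow> nat \<Rightarrow> int list \<Rightarrow> 'v list \<Rightarrow> 'v" where
  "increasing_sum lam F \<xi> r es vs =
    (\<Sum>ks \<in> arity_lists r (length vs).
       \<Sum>\<tau> | \<tau> \<in> Sh (rev ks @ [length vs - sum_list ks]) \<and>
             strict_mono_on {..<r} (\<lambda>k. \<tau> (sum_list (take k (rev ks)))).
         scale (koszul es \<tau> * lam ^ (r - 1))
           (F (tensor_val (map (\<lambda>m. (m, \<xi>)) (rev ks)) (permute_list \<tau> vs))))"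

lemma sum_shuffles_eq_increasing_sum:
  assumes F: "F \<in> Hom_Sbar scale V p" and \<xi>: "\<xi> \<in> Hom_Sbar scale V 0" and vs: "homog V es vs"
  shows "(\<Sum>ks \<in> arity_lists r (length vs). \<Sum>\<tau> \<in> Sh (rev ks @ [length vs - sum_list ks]).
         scale (lam ^ (r - 1) * koszul es \<tau>)
           (F (tensor_val (map (\<lambda>m. (m, \<xi>)) (rev ks)) (permute_list \<tau> vs)))) =
    scale (of_nat (fact r)) (increasing_sum lam F \<xi> r es vs)"
proof -
  let ?f = "\<lambda>Bs. scale (lam ^ (r - 1)) (block_term F \<xi> es vs Bs)"
  have f: "scale (lam ^ (r - 1) * koszul es \<tau>)
        (F (tensor_val (map (\<lambda>m. (m, \<xi>)) (rev ks)) (permute_list \<tau> vs))) =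
      ?f (blocks (rev ks) (map \<tau> [0..<length vs]))"
    if "ks \<in> arity_lists r (length vs)" "\<tau> \<in> Sh (rev ks @ [length vs - sum_list ks])" for ks \<tau>
    using shuffle_term_eq_block_term[OF that homog_lengthD[OF vs], of F \<xi>]
    by (simp flip: scale_scale)
  have "increasing_sum lam F \<xi> r es vs =
      (\<Sum>Bs | Bs \<in> index_blocks r (length vs) \<and> sorted (map hd Bs). ?f Bs)"
    unfolding increasing_sum_def sum_increasing_shuffles_eq_sum_blocks[of ?f, symmetric]
    by (intro sum.cong refl) (simp only: f mult.commute[of _ "lam ^ (r - 1)"] mem_Collect_eq)
  then have "scale (of_nat (fact r)) (increasing_sum lam F \<xi> r es vs) =
      scale (lam ^ (r - 1)) (\<Sum>Bs \<in> index_blocks r (length vs). block_term F \<xi> es vs Bs)"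
    by (simp add: sum_block_term[OF F \<xi> vs] scale_left_commute flip: scale_sum_right)
  also have "\<dots> = (\<Sum>ks \<in> arity_lists r (length vs). \<Sum>\<tau> \<in> Sh (rev ks @ [length vs - sum_list ks]).
         ?f (blocks (rev ks) (map \<tau> [0..<length vs])))"
    using sum_shuffles_eq_sum_blocks[of ?f] by (simp add: scale_sum_right)
  finally show ?thesis by (simp only: f cong: sum.cong)
qed

end

section \<open>The Maurer-Cartan equation\<close>

lemma tensor_exponent_0: "(\<And>x. x \<in> set l \<Longrightarrow> snd x = 0) \<Longrightarrow> tensor_exponent l es = 0"
proof (induction l es rule: tensor_exponent.induct)
  case (2 k q \<phi>s es)
  have "sum_list (map snd l) = 0" if "\<forall>x \<in> set l. snd x = 0" for l :: "(nat \<times> int) list"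
    using that by (induction l) auto
  with 2 show ?case by simp
qed simp

lemma arity_lists_1: "arity_lists 1 N = (\<lambda>m. [m]) ` {1..N}"
  by (auto simp: arity_lists_def length_Suc_conv)

lemma arity_lists_length_le: "ks \<in> arity_lists r N \<Longrightarrow> r \<le> sum_list ks"
proof (induction ks arbitrary: r)
  case (Cons k ks)
  then have "length ks \<le> sum_list ks" by (auto simp: arity_lists_def)
  with Cons.prems show ?case by (auto simp: arity_lists_def)
qed (simp add: arity_lists_def)

text \<open>Each input takes at least one argument. This bounds the number of inputs from
  \<open>A\<close> in a given output arity and so makes the Maurer-Cartan sum finite.\<close>

lemma arity_lists_empty: "N < r \<Longrightarrow> arity_lists r N = {}"
  using arity_lists_length_le by (fastforce simp: arity_lists_def)

lemma sum_arities_eq: "1 \<le> length xs \<Longrightarrow> sum_arities \<mu> xs = \<mu> (length xs) xs"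
  by (auto simp: sum_arities_def)

context graded_vector_space
begin

text \<open>The formula under \<open>ml_ext\<close> in \<open>pre_comp\<close>, on homogeneous
  arguments, where the identities live; \<open>pre_sum F F\<close> is the left-hand side of the
  relation of an L_infty[1]-algebra.\<close>

definition pre_sum :: "'v mmap \<Rightarrow> 'v mmap \<Rightarrow> int list \<Rightarrow> 'v list \<Rightarrow> 'v" where
  "pre_sum F G es vs = (\<Sum>m = 1..length vs. \<Sum>\<sigma> \<in> Sh [m, length vs - m].
     scale (koszul es \<sigma>) (F (G (take m (permute_list \<sigma> vs)) # drop m (permute_list \<sigma> vs))))"

lemma pre_comp_eq: "pre_comp scale V F G = ml_ext V (pre_sum F G)"
  by (simp add: pre_comp_def pre_sum_def[abs_def])

text \<open>With a single block the condition on first positions is vacuous, and the weight enters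
  as \<open>lam ^ 0\<close>, so any \<open>lam\<close> may stand on the right.\<close>

lemma pre_sum_eq_increasing_sum: "pre_sum F \<xi> = increasing_sum lam F \<xi> 1"
proof (intro ext)
  fix es vs
  show "pre_sum F \<xi> es vs = increasing_sum lam F \<xi> 1 es vs"
    unfolding pre_sum_def increasing_sum_def arity_lists_1
    by (subst sum.reindex) (auto simp: inj_on_def strict_mono_on_def intro!: sum.cong)
qed

text \<open>Inputs of degree 0 kill both sign exponents, the one from reversing the inputs and the
  one from the Koszul rule for tensor products. Only the sign of the shuffle remains.\<close>

lemma higher_op_replicate:
  assumes F: "F \<in> Hom_Sbar scale V p" and \<xi>: "\<xi> \<in> Hom_Sbar scale V 0"
  shows "higher_op scale V lam F (replicate r 0) (replicate r \<xi>) xs =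
    scale (of_nat (fact r)) (ml_ext V (increasing_sum lam F \<xi> r) xs)"
proof -
  have exponent: "(\<Sum>j<length (replicate r (0::int)). sum_list (take j (replicate r 0)) * replicate r (0::int) ! j) = 0"
    by (intro sum.neutral) auto
  have "higher_op scale V lam F (replicate r 0) (replicate r \<xi>) xs =
      ml_ext V (\<lambda>es vs. \<Sum>ks \<in> arity_lists r (length vs). \<Sum>\<tau> \<in> Sh (rev ks @ [length vs - sum_list ks]).
         scale (lam ^ (r - 1) * koszul es \<tau>)
           (F (tensor_val (map (\<lambda>m. (m, \<xi>)) (rev ks)) (permute_list \<tau> vs)))) xs"
    unfolding higher_op_def exponent length_replicate
  proof (rule ml_ext_cong, rule sum.cong, goal_cases)
    case 1
    show ?case by (simp add: arity_lists_def)
  next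
    case (2 es vs ks)
    then have "length ks = r" by (simp add: arity_lists_def)
    then have "tensor_exponent (rev (zip ks (replicate r 0))) es' = 0" for es'
      by (intro tensor_exponent_0) (auto dest: set_zip_rightD)
    moreover have "rev (zip ks (replicate r \<xi>)) = map (\<lambda>m. (m, \<xi>)) (rev ks)"
      using \<open>length ks = r\<close> by (simp add: zip_replicate2 rev_map)
    ultimately show ?case by simp
  qed
  also have "\<dots> = ml_ext V (\<lambda>es vs. scale (of_nat (fact r)) (increasing_sum lam F \<xi> r es vs)) xs"
    by (rule ml_ext_cong) (rule sum_shuffles_eq_increasing_sum[OF F \<xi>])
  finally show ?thesis by (simp only: ml_ext_scale)
qed

text \<open>For \<open>r = 1\<close> the operation is the bracket, whose second half keeps its minus
  sign because the exponent is \<open>1 * 0\<close>.\<close>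

lemma mixed_op_replicate:
  assumes F: "F \<in> Hom_Sbar scale V 1" and \<xi>: "\<xi> \<in> Hom_Sbar scale V 0" and "1 \<le> r"
  shows "mixed_op scale V lam 1 F (replicate r 0) (replicate r \<xi>) xs =
    scale (of_nat (fact r)) (ml_ext V (increasing_sum lam F \<xi> r) xs)
      - (if r = 1 then ml_ext V (pre_sum \<xi> F) xs else 0)"
proof (cases "r = 1")
  case True
  then show ?thesis
    by (simp add: mixed_op_def nr_bracket_def pre_comp_eq pre_sum_eq_increasing_sum[of F \<xi> lam])
qed (simp add: mixed_op_def higher_op_replicate[OF F \<xi>])

text \<open>In degree 0, moving any copy to the front costs no sign and leaves the same list of
  inputs, so the \<open>n\<close> summands coincide.\<close>

lemma snd_l_op_replicate:
  assumes "2 \<le> n"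
  shows "snd (l_op scale V lam (replicate n 0) (replicate n (F, \<xi>))) xs =
    scale (of_nat n) (mixed_op scale V lam 1 F (replicate (n - 1) 0) (replicate (n - 1) \<xi>) xs)"
proof -
  have omit: "omit k (replicate n x) = replicate (n - 1) x" if "k < n" for k and x :: 'c
    using that by (simp add: omit_def flip: replicate_add)
  have "snd (l_op scale V lam (replicate n 0) (replicate n (F, \<xi>))) xs =
      (\<Sum>k<n. mixed_op scale V lam 1 F (replicate (n - 1) 0) (replicate (n - 1) \<xi>) xs)"
    unfolding l_op_def Let_def snd_conv using assms
    by (auto intro!: sum.cong simp: omit)
  then show ?thesis by (simp add: sum_constant_scale)
qed

text \<open>With degree 1 assigned to \<open>F\<close>, the bracket of \<open>F\<close> with itself
  is twice the composite of \<open>F\<close> with itself, and the suspension contributes a further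
  sign -1; hence the constant -2.\<close>

lemma fst_l_op_replicate:
  "fst (l_op scale V lam (replicate n 0) (replicate n (F, \<xi>))) xs =
    (if n = 2 then scale (-2) (ml_ext V (pre_sum F F) xs) else 0)"
  by (simp add: l_op_def Let_def nr_bracket_def pre_comp_eq flip: scale_left_distrib scale_minus_left)
     (simp add: scale_left_distrib[of 1 1, simplified])

definition diff_sum :: "'k \<Rightarrow> 'v mmap \<Rightarrow> 'v mmap \<Rightarrow> int list \<Rightarrow> 'v list \<Rightarrow> 'v" where
  "diff_sum lam F \<xi> es vs =
     (\<Sum>r = 1..length vs. increasing_sum lam F \<xi> r es vs) - pre_sum \<xi> F es vs"

section \<open>Vanishing on zero arguments\<close>

text \<open>A zero either goes to an identity factor or sits in some block, on which \<xi> vanishes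
  by linearity. The outer map then vanishes too, which is what \<open>ml_ext_eq_0_iff\<close> asks
  for.\<close>

lemma zero_in_tensor_val:
  assumes "\<xi> \<in> Hom_Sbar scale V q" "0 \<in> set xs"
  shows "0 \<in> set (tensor_val (map (\<lambda>m. (m, \<xi>)) ks) xs)"
  using assms(2)
proof (induction ks arbitrary: xs)
  case (Cons k ks)
  have "0 \<in> set (take k xs) \<or> 0 \<in> set (drop k xs)"
    using Cons.prems by (metis Un_iff append_take_drop_id set_append)
  with Cons.IH Hom_Sbar_zero[OF assms(1)] show ?case by auto
qed simp

lemma permutes_Sh: "\<sigma> \<in> Sh ks \<Longrightarrow> \<sigma> permutes {..<sum_list ks}"
  by (simp add: Sh_def)

lemma increasing_sum_zero:
  assumes "F \<in> Hom_Sbar scale V p" "\<xi> \<in> Hom_Sbar scale V q" "0 \<in> set xs"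
  shows "increasing_sum lam F \<xi> r es xs = 0"
proof -
  have "F (tensor_val (map (\<lambda>m. (m, \<xi>)) (rev ks)) (permute_list \<tau> xs)) = 0"
    if "ks \<in> arity_lists r (length xs)" "\<tau> \<in> Sh (rev ks @ [length xs - sum_list ks])" for ks \<tau>
  proof -
    have "\<tau> permutes {..<length xs}" using Sh_rest_block(4)[OF that] .
    then have "0 \<in> set (permute_list \<tau> xs)" using assms(3) by simp
    then show ?thesis by (intro Hom_Sbar_zero[OF assms(1)] zero_in_tensor_val[OF assms(2)])
  qed
  then show ?thesis unfolding increasing_sum_def by (intro sum.neutral ballI) simp
qed

lemma pre_sum_zero:
  assumes "F \<in> Hom_Sbar scale V p" "G \<in> Hom_Sbar scale V q" "0 \<in> set xs"
  shows "pre_sum F G es xs = 0"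
proof -
  have "F (G (take m (permute_list \<tau> xs)) # drop m (permute_list \<tau> xs)) = 0"
    if "m \<in> {1..length xs}" "\<tau> \<in> Sh [m, length xs - m]" for m \<tau>
  proof -
    have "\<tau> permutes {..<length xs}" using permutes_Sh[OF that(2)] that(1) by simp
    then have "0 \<in> set (permute_list \<tau> xs)" using assms(3) by simp
    then show ?thesis
      using zero_in_tensor_val[OF assms(2), of _ "[m]"] by (intro Hom_Sbar_zero[OF assms(1)]) simp
  qed
  then show ?thesis unfolding pre_sum_def by (intro sum.neutral ballI) simp
qed

lemma diff_sum_zero:
  assumes "F \<in> Hom_Sbar scale V p" "\<xi> \<in> Hom_Sbar scale V q" "0 \<in> set xs"
  shows "diff_sum lam F \<xi> es xs = 0"
  using assms by (simp add: diff_sum_def increasing_sum_zero pre_sum_zero)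

section \<open>The defining identities as vanishing of sums over shuffles\<close>

lemma L_infty1_identities_iff:
  "L_infty1_identities scale V \<mu> \<longleftrightarrow>
    (\<forall>n\<ge>1. \<forall>es xs. length xs = n \<and> homog V es xs \<longrightarrow>
       pre_sum (sum_arities \<mu>) (sum_arities \<mu>) es xs = 0)"
proof -
  have "(\<Sum>i = 1..n. \<Sum>\<sigma> \<in> Sh [i, n - i]. scale (koszul es \<sigma>)
           (\<mu> (n - i + 1) (\<mu> i (take i (permute_list \<sigma> xs)) # drop i (permute_list \<sigma> xs)))) =
      pre_sum (sum_arities \<mu>) (sum_arities \<mu>) es xs" if "length xs = n" for n es xs
    unfolding pre_sum_def using that by (intro sum.cong) (auto simp: sum_arities_eq)
  then show ?thesis by (simp add: L_infty1_identities_def)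
qed

text \<open>Enough arguments are present for each factor to receive a list of exactly its arity, so
  the family picks the right component by length.\<close>

lemma tensor_val_sum_arities:
  assumes "sum_list ks \<le> length xs" "\<forall>k\<in>set ks. 1 \<le> k"
  shows "tensor_val (map (\<lambda>m. (m, sum_arities D)) ks) xs = tensor_val (map (\<lambda>m. (m, D m)) ks) xs"
  using assms
proof (induction ks arbitrary: xs)
  case (Cons k ks)
  then have "sum_list ks \<le> length (drop k xs)" by simp
  with Cons show ?case by (simp add: sum_arities_eq)
qed simp

lemma length_tensor_val: "sum_list (map fst \<phi>s) \<le> length xs \<Longrightarrow>
    length (tensor_val \<phi>s xs) = length \<phi>s + (length xs - sum_list (map fst \<phi>s))"
  by (induction \<phi>s xs rule: tensor_val.induct) auto

text \<open>For each \<open>p\<close> the sums over \<open>t\<close> and \<open>ms\<close> merge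
  into one over \<open>arity_lists (p - 1) n\<close>, and the component of \<mu> is recovered from
  the number of its arguments.\<close>

lemma diff_identities_iff:
  "diff_identities scale V lam \<mu> D \<longleftrightarrow>
    (\<forall>n\<ge>1. \<forall>es xs. length xs = n \<and> homog V es xs \<longrightarrow>
       diff_sum lam (sum_arities \<mu>) (sum_arities D) es xs = 0)"
proof -
  have total: "(\<Sum>p = 2..n + 1. \<Sum>t = p - 1..n.
       \<Sum>ms | length ms = p - 1 \<and> (\<forall>m \<in> set ms. 1 \<le> m) \<and> sum_list ms = t.
       \<Sum>\<sigma> | \<sigma> \<in> Sh (rev ms @ [n - t]) \<and>
             strict_mono_on {..<p - 1} (\<lambda>k. \<sigma> (sum_list (take k (rev ms)))).
         scale (koszul es \<sigma> * lam ^ (p - 2))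
           (\<mu> (n - t + p - 1)
              (tensor_val (map (\<lambda>m. (m, D m)) (rev ms)) (permute_list \<sigma> xs))))
      - (\<Sum>j = 1..n. \<Sum>\<sigma> \<in> Sh [j, n - j].
         scale (koszul es \<sigma>)
           (D (n - j + 1) (\<mu> j (take j (permute_list \<sigma> xs)) # drop j (permute_list \<sigma> xs)))) =
      diff_sum lam (sum_arities \<mu>) (sum_arities D) es xs"
    if n: "length xs = n" for n es xs
  proof -
    define S where "S p t ms = (\<Sum>\<sigma> | \<sigma> \<in> Sh (rev ms @ [n - t]) \<and>
             strict_mono_on {..<p - 1} (\<lambda>k. \<sigma> (sum_list (take k (rev ms)))).
         scale (koszul es \<sigma> * lam ^ (p - 2))
           (\<mu> (n - t + p - 1)
              (tensor_val (map (\<lambda>m. (m, D m)) (rev ms)) (permute_list \<sigma> xs))))" for p t ms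
    let ?g = "\<lambda>r. increasing_sum lam (sum_arities \<mu>) (sum_arities D) r es xs"
    have first: "(\<Sum>t = p - 1..n.
         \<Sum>ms | length ms = p - 1 \<and> (\<forall>m \<in> set ms. 1 \<le> m) \<and> sum_list ms = t. S p t ms) = ?g (p - 1)"
      if p: "p \<in> {2..n + 1}" for p
    proof -
      have "(\<Sum>t = p - 1..n. \<Sum>ms | length ms = p - 1 \<and> (\<forall>m \<in> set ms. 1 \<le> m) \<and> sum_list ms = t. S p t ms) =
          (\<Sum>t = p - 1..n. \<Sum>ms | ms \<in> arity_lists (p - 1) n \<and> sum_list ms = t. S p (sum_list ms) ms)"
        by (intro sum.cong) (auto simp: arity_lists_def)
      \<comment> \<open>Grouping by the total: every entry is at least 1, so the smallest total is
        \<open>p - 1\<close>.\<close>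
      also have "\<dots> = (\<Sum>ms \<in> arity_lists (p - 1) n. S p (sum_list ms) ms)"
        by (rule sum.group)
           (use arity_lists_length_le in \<open>auto simp: finite_arity_lists\<close>, auto simp: arity_lists_def)
      also have "\<dots> = ?g (p - 1)"
        unfolding increasing_sum_def n S_def
      proof (intro sum.cong refl)
        fix ks \<sigma> assume ks: "ks \<in> arity_lists (p - 1) n"
        have ks': "sum_list (rev ks) \<le> length (permute_list \<sigma> xs)" "\<forall>k\<in>set (rev ks). 1 \<le> k"
          "length ks = p - 1"
          using ks n by (auto simp: arity_lists_def)
        let ?ys = "tensor_val (map (\<lambda>m. (m, D m)) (rev ks)) (permute_list \<sigma> xs)"
        have "length ?ys = n - sum_list ks + p - 1"
          using ks' n p by (subst length_tensor_val) (auto simp: o_def simp flip: rev_map)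
        \<comment> \<open>The list must be nonempty, since \<open>sum_arities\<close> discards
          \<open>\<mu> 0\<close>.\<close>
        moreover have "1 \<le> n - sum_list ks + p - 1" using p by auto
        ultimately have "sum_arities \<mu> ?ys = \<mu> (n - sum_list ks + p - 1) ?ys"
          using sum_arities_eq[of ?ys \<mu>] by simp
        then show "scale (koszul es \<sigma> * lam ^ (p - 2)) (\<mu> (n - sum_list ks + p - 1) ?ys) =
            scale (koszul es \<sigma> * lam ^ (p - 1 - 1)) (sum_arities \<mu>
              (tensor_val (map (\<lambda>m. (m, sum_arities D)) (rev ks)) (permute_list \<sigma> xs)))"
          by (simp add: tensor_val_sum_arities[OF ks'(1,2)] numeral_2_eq_2)
      qed
      finally show ?thesis .
    qed
    have second: "(\<Sum>j = 1..n. \<Sum>\<sigma> \<in> Sh [j, n - j]. scale (koszul es \<sigma>)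
             (D (n - j + 1) (\<mu> j (take j (permute_list \<sigma> xs)) # drop j (permute_list \<sigma> xs)))) =
        pre_sum (sum_arities D) (sum_arities \<mu>) es xs"
      unfolding pre_sum_def using n by (intro sum.cong) (auto simp: sum_arities_eq)
    have "(\<Sum>p = 2..n + 1. \<Sum>t = p - 1..n.
         \<Sum>ms | length ms = p - 1 \<and> (\<forall>m \<in> set ms. 1 \<le> m) \<and> sum_list ms = t. S p t ms) =
        (\<Sum>p = 2..n + 1. ?g (p - 1))"
      by (rule sum.cong[OF refl first])
    also have "\<dots> = (\<Sum>r = 1..n. ?g r)"
      using sum.shift_bounds_cl_Suc_ivl[of "\<lambda>p. ?g (p - 1)" 1 n] by (simp add: numeral_2_eq_2)
    finally show ?thesis
      unfolding second S_def diff_sum_def n by simp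
  qed
  show ?thesis
    unfolding diff_identities_def by (intro all_cong1 imp_cong refl) (simp only: total)
qed

section \<open>Families of maps and the suspended grading\<close>

text \<open>Maps of arity \<open>i\<close> vanish on lists of any other length, so cutting the sum
  by length recovers the family. The extensional product leaves no freedom at index 0, where
  \<open>sum_arities\<close> would fail to be injective.\<close>

lemma bij_betw_sum_arities:
  "bij_betw sum_arities (\<Pi>\<^sub>E i\<in>{1..}. Hom_Sym scale V i p) (Hom_Sbar scale V p)"
proof (rule bij_betw_byWitness[where f' = "\<lambda>F. \<lambda>i\<in>{1..}. arity_part i F"])
  have part: "arity_part i (sum_arities \<mu>) = \<mu> i"
    if \<mu>: "\<mu> \<in> (\<Pi>\<^sub>E i\<in>{1..}. Hom_Sym scale V i p)" and i: "1 \<le> i" for \<mu> i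
  proof
    fix xs
    have "\<mu> i \<in> Hom_Sym scale V i p" using PiE_mem[OF \<mu>, of i] i by simp
    then show "arity_part i (sum_arities \<mu>) xs = \<mu> i xs"
      using i by (auto simp: arity_part_def sum_arities_def Hom_Sym_def)
  qed
  show "\<forall>\<mu>\<in>\<Pi>\<^sub>E i\<in>{1..}. Hom_Sym scale V i p. (\<lambda>i\<in>{1..}. arity_part i (sum_arities \<mu>)) = \<mu>"
  proof
    fix \<mu> assume \<mu>: "\<mu> \<in> (\<Pi>\<^sub>E i\<in>{1..}. Hom_Sym scale V i p)"
    show "(\<lambda>i\<in>{1..}. arity_part i (sum_arities \<mu>)) = \<mu>"
      by (rule ext) (use part[OF \<mu>] PiE_arb[OF \<mu>] in auto)
  qed
  show "\<forall>F\<in>Hom_Sbar scale V p. sum_arities (\<lambda>i\<in>{1..}. arity_part i F) = F"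
    by (auto simp: Hom_Sbar_def sum_arities_def arity_part_def Suc_le_eq fun_eq_iff)
  show "sum_arities ` (\<Pi>\<^sub>E i\<in>{1..}. Hom_Sym scale V i p) \<subseteq> Hom_Sbar scale V p"
  proof
    fix F assume "F \<in> sum_arities ` (\<Pi>\<^sub>E i\<in>{1..}. Hom_Sym scale V i p)"
    then obtain \<mu> where \<mu>: "\<mu> \<in> (\<Pi>\<^sub>E i\<in>{1..}. Hom_Sym scale V i p)" and F: "F = sum_arities \<mu>"
      by blast
    have "arity_part n F \<in> Hom_Sym scale V n p" if "1 \<le> n" for n
      using PiE_mem[OF \<mu>, of n] part[OF \<mu> that] that F by simp
    then show "F \<in> Hom_Sbar scale V p"
      by (simp add: Hom_Sbar_def F sum_arities_def[abs_def])
  qed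
  show "(\<lambda>F. \<lambda>i\<in>{1..}. arity_part i F) ` Hom_Sbar scale V p \<subseteq> (\<Pi>\<^sub>E i\<in>{1..}. Hom_Sym scale V i p)"
    by (auto simp: Hom_Sbar_def)
qed

end

text \<open>Shifting the index by one matches the decompositions of a vector in the two gradings and
  shifts their supports.\<close>

lemma graded_vector_space_susp:
  assumes "graded_vector_space scale G"
  shows "graded_vector_space scale (susp G)"
proof -
  interpret graded_vector_space scale G by fact
  show ?thesis
  proof
    show "subspace (susp G d)" for d by (simp add: susp_def subspace_component)
    fix x
    have reindex: "finite {d. c (d + 1) \<noteq> 0} \<longleftrightarrow> finite {d. c d \<noteq> 0}"
        "(\<Sum>d | c (d + 1) \<noteq> 0. c (d + 1)) = (\<Sum>d | c d \<noteq> 0. c d)" for c :: "int \<Rightarrow> 'b"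
    proof -
      have bij: "bij_betw (\<lambda>d. d + 1) {d. c (d + 1) \<noteq> 0} {d. c d \<noteq> 0}"
        by (rule bij_betw_byWitness[where f' = "\<lambda>d. d - 1"]) auto
      show "finite {d. c (d + 1) \<noteq> 0} \<longleftrightarrow> finite {d. c d \<noteq> 0}"
        using bij_betw_finite[OF bij] .
      show "(\<Sum>d | c (d + 1) \<noteq> 0. c (d + 1)) = (\<Sum>d | c d \<noteq> 0. c d)"
        using sum.reindex_bij_betw[OF bij, of c] .
    qed
    let ?P = "\<lambda>c. (\<forall>d. c d \<in> G d) \<and> finite {d. c d \<noteq> 0} \<and> x = (\<Sum>d | c d \<noteq> 0. c d)"
    let ?Q = "\<lambda>c. (\<forall>d. c d \<in> susp G d) \<and> finite {d. c d \<noteq> 0} \<and> x = (\<Sum>d | c d \<noteq> 0. c d)"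
    have Q_shift: "?Q (\<lambda>d. c (d + 1)) \<longleftrightarrow> ?P c" for c
    proof -
      have "(\<forall>d. c (d + 1) \<in> G (d + 1)) \<longleftrightarrow> (\<forall>d. c d \<in> G d)"
        by (metis diff_add_cancel)
      then show ?thesis using reindex[of c] by (simp add: susp_def)
    qed
    obtain c where c: "?P c" and unique: "\<And>c'. ?P c' \<Longrightarrow> c' = c"
      using decomposition[of x] by (elim ex1E) blast
    show "\<exists>!c. ?Q c"
    proof (rule ex1I)
      show "?Q (\<lambda>d. c (d + 1))" using Q_shift c by blast
      fix c' assume "?Q c'"
      then have "?P (\<lambda>d. c' (d - 1))" using Q_shift[of "\<lambda>d. c' (d - 1)"] by simp
      then have "(\<lambda>d. c' (d - 1)) = c" by (rule unique)
      then show "c' = (\<lambda>d. c (d + 1))" by auto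
    qed
  qed
qed

text \<open>In each arity the two components of the Maurer-Cartan sum are \<open>ml_ext\<close> of
  \<open>pre_sum F F\<close>, up to sign, and of \<open>diff_sum lam F \<xi>\<close>; vanishing then
  passes from all lists to homogeneous ones.\<close>

lemma Maurer_Cartan_iff:
  fixes scale :: "'k::field_char_0 \<Rightarrow> 'v::ab_group_add \<Rightarrow> 'v"
  assumes "graded_vector_space scale V"
    and F: "F \<in> Hom_Sbar scale V 1" and \<xi>: "\<xi> \<in> Hom_Sbar scale V 0"
  shows "(F, \<xi>) \<in> Maurer_Cartan scale V lam \<longleftrightarrow>
    (\<forall>n\<ge>1. \<forall>es xs. length xs = n \<and> homog V es xs \<longrightarrow>
       graded_vector_space.pre_sum scale F F es xs = 0) \<and>
    (\<forall>n\<ge>1. \<forall>es xs. length xs = n \<and> homog V es xs \<longrightarrow>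
       graded_vector_space.diff_sum scale lam F \<xi> es xs = 0)"
proof -
  interpret graded_vector_space scale V by fact
  define l where "l n = l_op scale V lam (replicate n 0) (replicate n (F, \<xi>))" for n
  define I where
    "I N = {n. 1 \<le> n \<and> (\<exists>xs. length xs = N \<and> (fst (l n) xs \<noteq> 0 \<or> snd (l n) xs \<noteq> 0))}" for N
  have fst_l: "fst (l n) xs = (if n = 2 then scale (-2) (ml_ext V (pre_sum F F) xs) else 0)" for n xs
    unfolding l_def by (rule fst_l_op_replicate)
  have increasing_0: "ml_ext V (increasing_sum lam F \<xi> r) xs = 0" if "length xs < r" for r xs
  proof -
    have "ml_ext V (increasing_sum lam F \<xi> r) xs = ml_ext V (\<lambda>_ _. 0) xs"
      by (rule ml_ext_cong) (use that in \<open>simp add: increasing_sum_def arity_lists_empty\<close>)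
    then show ?thesis by (simp add: ml_ext_def)
  qed
  have snd_l: "scale (1 / fact n) (snd (l n) xs) = ml_ext V (increasing_sum lam F \<xi> (n - 1)) xs
      - (if n = 2 then ml_ext V (pre_sum \<xi> F) xs else 0)" if "2 \<le> n" for n xs
  proof -
    have "1 / fact n * of_nat n * of_nat (fact (n - 1)) = (1 :: 'k)"
      using that fact_reduce[of n, where 'a = 'k] by simp
    then have "scale (1 / fact n) (scale (of_nat n) (scale (of_nat (fact (n - 1))) v)) = v" for v
      by simp
    moreover have "n - 1 = 1 \<longleftrightarrow> n = 2" using that by auto
    ultimately show ?thesis
      unfolding l_def snd_l_op_replicate[OF that]
      using that mixed_op_replicate[OF F \<xi>, of "n - 1" lam xs]
      by (cases "n = 2") (simp_all add: scale_right_diff_distrib)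
  qed
  \<comment> \<open>In arity \<open>N\<close> the sums over blocks vanish once
    \<open>n - 1 > N\<close>. The bound \<open>N + 2\<close> keeps \<open>n = 2\<close>, where the
    other half of the bracket and the first component live, inside the interval even for
    \<open>N = 0\<close>.\<close>
  have I_subset: "I N \<subseteq> {2..N + 2}" for N
  proof
    fix n assume "n \<in> I N"
    then obtain xs where xs: "length xs = N" "1 \<le> n" "fst (l n) xs \<noteq> 0 \<or> snd (l n) xs \<noteq> 0"
      by (auto simp: I_def)
    have "n \<noteq> 1" using xs by (auto simp: fst_l l_def l_op_def Let_def)
    moreover have "n \<le> N + 2"
    proof (rule ccontr)
      assume "\<not> n \<le> N + 2"
      then have "snd (l n) xs = 0"
        using snd_l[of n xs] increasing_0[of xs "n - 1"] xs(1) by simp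
      with \<open>\<not> n \<le> N + 2\<close> xs(3) show False by (simp add: fst_l)
    qed
    ultimately show "n \<in> {2..N + 2}" using xs(2) by simp
  qed
  \<comment> \<open>\<open>I\<close> depends on which terms happen to vanish; the interval differs
    from it by zero terms only and does not depend on \<mu> or on the component.\<close>
  have restrict: "(\<Sum>n \<in> I (length xs). scale (1 / fact n) (f (l n) xs)) =
      (\<Sum>n = 2..length xs + 2. scale (1 / fact n) (f (l n) xs))"
    if "f = fst \<or> f = snd" for f and xs :: "'v list"
  proof (rule sum.mono_neutral_left)
    show "\<forall>n \<in> {2..length xs + 2} - I (length xs). scale (1 / fact n) (f (l n) xs) = 0"
    proof
      fix n assume "n \<in> {2..length xs + 2} - I (length xs)"
      then have "fst (l n) xs = 0" "snd (l n) xs = 0" by (auto simp: I_def)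
      with that show "scale (1 / fact n) (f (l n) xs) = 0" by auto
    qed
  qed (rule finite_atLeastAtMost I_subset)+
  have delta: "(\<Sum>n = 2..N + 2. if n = 2 then c else 0) = c" for N :: nat and c :: 'v
    by (subst sum.delta) auto
  have sum_fst: "(\<Sum>n \<in> I (length xs). scale (1 / fact n) (fst (l n) xs)) =
      - ml_ext V (pre_sum F F) xs" for xs
  proof -
    have "(\<Sum>n = 2..length xs + 2. scale (1 / fact n) (fst (l n) xs)) =
        (\<Sum>n = 2..length xs + 2. if n = 2 then - ml_ext V (pre_sum F F) xs else 0)"
      by (intro sum.cong) (auto simp: fst_l)
    then show ?thesis using restrict[of fst xs] unfolding delta by simp
  qed
  have sum_snd: "(\<Sum>n \<in> I (length xs). scale (1 / fact n) (snd (l n) xs)) =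
      ml_ext V (diff_sum lam F \<xi>) xs" for xs
  proof -
    let ?g = "\<lambda>r. ml_ext V (increasing_sum lam F \<xi> r) xs"
    have "(\<Sum>n = 2..length xs + 2. scale (1 / fact n) (snd (l n) xs)) =
        (\<Sum>n = 2..length xs + 2. ?g (n - 1))
        - (\<Sum>n = 2..length xs + 2. if n = 2 then ml_ext V (pre_sum \<xi> F) xs else 0)"
      unfolding sum_subtractf[symmetric] by (intro sum.cong) (auto simp: snd_l)
    also have "(\<Sum>n = 2..length xs + 2. ?g (n - 1)) = (\<Sum>r = 1..length xs + 1. ?g r)"
      using sum.shift_bounds_cl_Suc_ivl[of "\<lambda>n. ?g (n - 1)" 1 "length xs + 1"]
      by (simp add: numeral_2_eq_2)
    \<comment> \<open>The top index \<open>length xs + 1\<close> asks for more blocks than there are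
      arguments.\<close>
    also have "\<dots> = (\<Sum>r = 1..length xs. ?g r)" by (simp add: increasing_0)
    also have "\<dots> - (\<Sum>n = 2..length xs + 2. if n = 2 then ml_ext V (pre_sum \<xi> F) xs else 0) =
        ml_ext V (\<lambda>es vs. (\<Sum>r = 1..length xs. increasing_sum lam F \<xi> r es vs) - pre_sum \<xi> F es vs) xs"
      unfolding delta by (simp only: ml_ext_diff ml_ext_sum)
    also have "\<dots> = ml_ext V (diff_sum lam F \<xi>) xs"
      by (rule ml_ext_cong) (simp add: diff_sum_def)
    finally show ?thesis using restrict[of snd xs] by simp
  qed
  \<comment> \<open>Output arity 0 is part of \<open>Maurer_Cartan\<close> but not of the
    identities; there the outer sums range over \<open>{1..0}\<close>.\<close>
  have empty: "ml_ext V (pre_sum F F) [] = 0" "ml_ext V (diff_sum lam F \<xi>) [] = 0"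
    by (simp_all add: ml_ext_def pre_sum_def diff_sum_def)
  have homog_F: "(\<forall>xs. length xs = n \<longrightarrow> ml_ext V (pre_sum F F) xs = 0) \<longleftrightarrow>
      (\<forall>es xs. length xs = n \<and> homog V es xs \<longrightarrow> pre_sum F F es xs = 0)" for n
    by (rule ml_ext_eq_0_iff) (rule pre_sum_zero[OF F F])
  have homog_D: "(\<forall>xs. length xs = n \<longrightarrow> ml_ext V (diff_sum lam F \<xi>) xs = 0) \<longleftrightarrow>
      (\<forall>es xs. length xs = n \<and> homog V es xs \<longrightarrow> diff_sum lam F \<xi> es xs = 0)" for n
    by (rule ml_ext_eq_0_iff) (rule diff_sum_zero[OF F \<xi>])
  have "(F, \<xi>) \<in> Maurer_Cartan scale V lam \<longleftrightarrow> (F, \<xi>) \<in> sM_A scale V 0 \<and>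
      (\<forall>N. finite (I N) \<and> (\<forall>xs. length xs = N \<longrightarrow>
        (\<Sum>n \<in> I N. scale (1 / fact n) (fst (l n) xs)) = 0 \<and>
        (\<Sum>n \<in> I N. scale (1 / fact n) (snd (l n) xs)) = 0))"
    unfolding Maurer_Cartan_def Let_def mem_Collect_eq I_def l_def by (rule refl)
  also have "\<dots> \<longleftrightarrow> (\<forall>N xs. length xs = N \<longrightarrow>
      ml_ext V (pre_sum F F) xs = 0 \<and> ml_ext V (diff_sum lam F \<xi>) xs = 0)"
  proof -
    have "finite (I N)" for N by (rule finite_subset[OF I_subset]) simp
    moreover have "(F, \<xi>) \<in> sM_A scale V 0" using F \<xi> by (simp add: sM_A_def susp_def)
    moreover have "(\<Sum>n \<in> I N. scale (1 / fact n) (fst (l n) xs)) = 0 \<and>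
        (\<Sum>n \<in> I N. scale (1 / fact n) (snd (l n) xs)) = 0 \<longleftrightarrow>
        ml_ext V (pre_sum F F) xs = 0 \<and> ml_ext V (diff_sum lam F \<xi>) xs = 0" if "length xs = N" for N xs
      using sum_fst[of xs] sum_snd[of xs] that by simp
    ultimately show ?thesis by (simp cong: conj_cong)
  qed
  also have "\<dots> \<longleftrightarrow> (\<forall>n\<ge>1. \<forall>xs. length xs = n \<longrightarrow>
      ml_ext V (pre_sum F F) xs = 0 \<and> ml_ext V (diff_sum lam F \<xi>) xs = 0)" (is "?A \<longleftrightarrow> ?B")
  proof
    assume ?B
    show ?A
    proof (intro allI impI)
      fix N and xs :: "'v list" assume "length xs = N"
      with \<open>?B\<close> empty show "ml_ext V (pre_sum F F) xs = 0 \<and> ml_ext V (diff_sum lam F \<xi>) xs = 0"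
        by (cases "xs = []") (auto simp: Suc_le_eq)
    qed
  qed simp
  also have "\<dots> \<longleftrightarrow> (\<forall>n\<ge>1. \<forall>xs. length xs = n \<longrightarrow> ml_ext V (pre_sum F F) xs = 0) \<and>
      (\<forall>n\<ge>1. \<forall>xs. length xs = n \<longrightarrow> ml_ext V (diff_sum lam F \<xi>) xs = 0)"
    by blast
  finally show ?thesis unfolding homog_F homog_D .
qed

lemma image_Collect_eq: "C \<subseteq> f ` A \<Longrightarrow> f ` {x \<in> A. f x \<in> C} = C"
  by blast

theorem theorem5p5:
  fixes scale :: "'k::field_char_0 \<Rightarrow> 'v::ab_group_add \<Rightarrow> 'v"
    and G :: "int \<Rightarrow> 'v set"
    and lam :: 'k
  assumes "graded_vector_space scale G"
  shows "bij_betw (\<lambda>(\<mu>, D). (sum_arities \<mu>, sum_arities D))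
    {(\<mu>, D).
       \<mu> \<in> (\<Pi>\<^sub>E i\<in>{1..}. Hom_Sym scale (susp G) i 1) \<and>
       D \<in> (\<Pi>\<^sub>E i\<in>{1..}. Hom_Sym scale (susp G) i 0) \<and>
       L_infty1_identities scale (susp G) \<mu> \<and>
       diff_identities scale (susp G) lam \<mu> D}
    (homotopy_diff_Lie scale lam G)"
proof -
  have graded: "graded_vector_space scale (susp G)"
    using assms by (rule graded_vector_space_susp)
  then interpret graded_vector_space scale "susp G" .
  let ?P = "\<lambda>p. \<Pi>\<^sub>E i\<in>{1..}. Hom_Sym scale (susp G) i p"
  let ?f = "\<lambda>(\<mu>, D). (sum_arities \<mu>, sum_arities D)"
  let ?S = "{(\<mu>, D). \<mu> \<in> ?P 1 \<and> D \<in> ?P 0 \<and> L_infty1_identities scale (susp G) \<mu> \<and>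
       diff_identities scale (susp G) lam \<mu> D}"
  have bij: "bij_betw ?f (?P 1 \<times> ?P 0) (Hom_Sbar scale (susp G) 1 \<times> Hom_Sbar scale (susp G) 0)"
    using bij_betw_map_prod[OF bij_betw_sum_arities[of 1] bij_betw_sum_arities[of 0]]
    by (simp only: map_prod_def)
  have iff: "(sum_arities \<mu>, sum_arities D) \<in> homotopy_diff_Lie scale lam G \<longleftrightarrow>
      L_infty1_identities scale (susp G) \<mu> \<and> diff_identities scale (susp G) lam \<mu> D"
    if "\<mu> \<in> ?P 1" "D \<in> ?P 0" for \<mu> D
    unfolding homotopy_diff_Lie_def L_infty1_identities_iff diff_identities_iff
    by (rule Maurer_Cartan_iff[OF graded that[THEN bij_betw_apply[OF bij_betw_sum_arities]]])
  have S: "?S = {x \<in> ?P 1 \<times> ?P 0. ?f x \<in> homotopy_diff_Lie scale lam G}"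
  proof (rule set_eqI)
    show "x \<in> ?S \<longleftrightarrow> x \<in> {x \<in> ?P 1 \<times> ?P 0. ?f x \<in> homotopy_diff_Lie scale lam G}" for x
      unfolding mem_Collect_eq mem_Times_iff case_prod_beta using iff[of "fst x" "snd x"] by argo
  qed
  \<comment> \<open>For surjectivity: a Maurer-Cartan element has degree 0, so by the suspension its
    components have degrees 1 and 0, and it comes from a pair of families.\<close>
  have "homotopy_diff_Lie scale lam G \<subseteq> sM_A scale (susp G) 0"
    unfolding homotopy_diff_Lie_def Maurer_Cartan_def by (rule Collect_restrict)
  also have "\<dots> = ?f ` (?P 1 \<times> ?P 0)"
    unfolding bij_betw_imp_surj_on[OF bij] sM_A_def susp_def by simp
  finally have "?f ` ?S = homotopy_diff_Lie scale lam G"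
    unfolding S by (rule image_Collect_eq)
  then show ?thesis
    by (rule bij_betw_subset[OF bij, rotated]) (simp only: S Collect_restrict)
qed

end
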